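(* There exists a constant $C>0$ such that $$\sup_{\|w\|_{H^1(\mathbb R^{2}_{+})}\le 1}\ \int_{\mathbb R}\left(e^{\alpha (w(x,0))^2}-1\right)dx\le C\qquad\text{for all } 0<\alpha<\pi .$$
   Context: $\mathbb R^2_+=\{(x,y)\in\mathbb R^2: y>0\}$, $\|w\|_{H^1(\mathbb R^2_+)}^2=\int_{\mathbb R^2_+}(|\nabla w|^2+|w|^2)\,dx\,dy$, and $w(\cdot,0)$ denotes the trace of $w$ on the boundary $\mathbb R\times\{0\}$. *)

theory Defs
  imports "HOL-Analysis.Analysis"
begin

definition upper_half_plane :: "(real \<times> real) set" where
  "upper_half_plane = {(x, y). y > 0}"

text \<open>
  \<open>Ck k f\<close>: the function is \<open>k\<close> times continuously differentiable on the whole plane,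
  i.e. it is differentiable everywhere with partial derivatives of class \<open>k - 1\<close>.
\<close>

fun Ck :: "nat \<Rightarrow> (real \<times> real \<Rightarrow> real) \<Rightarrow> bool" where
  "Ck 0 f \<longleftrightarrow> continuous_on UNIV f"
| "Ck (Suc k) f \<longleftrightarrow>
     (\<exists>D. (\<forall>p. GDERIV f p :> D p) \<and> Ck k (\<lambda>p. fst (D p)) \<and> Ck k (\<lambda>p. snd (D p)))"

definition test_function :: "(real \<times> real) set \<Rightarrow> (real \<times> real \<Rightarrow> real) \<Rightarrow> bool" where
  "test_function U \<phi> \<longleftrightarrow>
     (\<forall>k. Ck k \<phi>) \<and> compact (closure {p. \<phi> p \<noteq> 0}) \<and> closure {p. \<phi> p \<noteq> 0} \<subseteq> U"

definition L2_on :: "'a::euclidean_space set \<Rightarrow> ('a \<Rightarrow> 'b::euclidean_space) \<Rightarrow> bool" where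
  "L2_on S f \<longleftrightarrow> f \<in> borel_measurable (lebesgue_on S) \<and>
     integrable (lebesgue_on S) (\<lambda>x. (norm (f x))\<^sup>2)"

text \<open>
  \<open>G\<close> is an \<open>L\<^sup>2\<close> function representing the distributional gradient of \<open>w\<close> on the half-plane.
\<close>

definition has_weak_gradient ::
    "(real \<times> real \<Rightarrow> real) \<Rightarrow> (real \<times> real \<Rightarrow> real \<times> real) \<Rightarrow> bool" where
  "has_weak_gradient w G \<longleftrightarrow> L2_on upper_half_plane G \<and>
     (\<forall>\<phi> D. test_function upper_half_plane \<phi> \<longrightarrow> (\<forall>p. GDERIV \<phi> p :> D p) \<longrightarrow>
        integral\<^sup>L (lebesgue_on upper_half_plane) (\<lambda>p. w p *\<^sub>R D p) =
        - integral\<^sup>L (lebesgue_on upper_half_plane) (\<lambda>p. \<phi> p *\<^sub>R G p))"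

definition H1 :: "(real \<times> real \<Rightarrow> real) set" where
  "H1 = {w. L2_on upper_half_plane w \<and> (\<exists>G. has_weak_gradient w G)}"

text \<open>The weak gradient is unique only up to null sets; some representative is chosen.\<close>

definition weak_gradient :: "(real \<times> real \<Rightarrow> real) \<Rightarrow> real \<times> real \<Rightarrow> real \<times> real" where
  "weak_gradient w = (SOME G. has_weak_gradient w G)"

definition H1_norm :: "(real \<times> real \<Rightarrow> real) \<Rightarrow> real" where
  "H1_norm w = sqrt (integral\<^sup>L (lebesgue_on upper_half_plane)
     (\<lambda>p. (norm (weak_gradient w p))\<^sup>2 + \<bar>w p\<bar>\<^sup>2))"

text \<open>
  \<open>g\<close> represents the trace of \<open>w\<close>: the trace operator is the continuous extension, from the
  restrictions of functions in \<open>C\<^sub>c\<^sup>\<infinity>(\<real>\<^sup>2)\<close> to all of \<open>H\<^sup>1\<close>, of \<open>\<phi> \<mapsto> \<phi>(\<cdot>, 0) \<in> L\<^sup>2(\<real>)\<close>.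
  As \<open>g\<close> is determined only up to null sets, the trace is rendered as a relation.
\<close>

definition has_trace :: "(real \<times> real \<Rightarrow> real) \<Rightarrow> (real \<Rightarrow> real) \<Rightarrow> bool" where
  "has_trace w g \<longleftrightarrow> w \<in> H1 \<and> L2_on UNIV g \<and>
     (\<exists>\<phi>. (\<forall>n. test_function UNIV (\<phi> n)) \<and>
        (\<lambda>n. H1_norm (\<lambda>p. \<phi> n p - w p)) \<longlonglongrightarrow> 0 \<and>
        (\<lambda>n. integral\<^sup>L lebesgue (\<lambda>x. (\<phi> n (x, 0) - g x)\<^sup>2)) \<longlonglongrightarrow> 0)"

end

theory Submission
  imports Defs "HOL-Real_Asymp.Real_Asymp"
begin

text \<open>
  Integrating \<open>\<phi>(z + r e\<^sup>i\<^sup>\<theta>) cos r\<close> over \<open>0 < r < \<pi>/2\<close> and averaging over the directions of the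
  half-plane gives \<open>\<bar>\<phi>(z, 0)\<bar> \<le> (1/\<pi>) \<integral> F(p) / \<bar>p - z\<bar> dp\<close>, the integral being over the half-disc of radius \<open>\<pi>/2\<close>, with
  \<open>F\<^sup>2 = \<bar>\<nabla>\<phi>\<bar>\<^sup>2 + \<phi>\<^sup>2\<close>. The square of this kernel has integral \<open>(1/\<pi>) ln (\<pi>/(2\<rho>))\<close> outside the disc
  of radius \<open>\<rho>\<close>, whence the constant \<open>\<pi>\<close>. Adams' argument then yields the exponential inequality: cut \<open>F\<close> at
  its superlevel set of measure \<open>\<rho>\<^sup>2\<close>, carrying the energy \<open>L\<^sup>2\<close>. If \<open>\<bar>{\<pi> \<phi>\<^sup>2 > n}\<bar>\<close> is comparable
  to its maximal size \<open>e\<^sup>-\<^sup>n\<close> for one large \<open>n\<close>, then \<open>L\<^sup>2\<close> is of order \<open>1/n\<close> and the remaining energy is too small for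
  the same to happen at much higher levels; so \<open>\<Sum> e\<^sup>n \<bar>{\<pi> \<phi>\<^sup>2 > n}\<bar>\<close> is bounded.

  A trace is a limit of test functions whose energy is asymptotically at most \<open>1\<close>, and \<open>\<alpha> < \<pi>\<close>
  leaves room to rescale them before Fatou's lemma is applied.
\<close>

section \<open>Polar coordinates in the half-plane\<close>

text \<open>The bound must stay uniform as \<alpha> approaches \<pi>. The level set estimate at a
  single scale only bounds \<open>exp n\<close> times the measure of the n-th level set for every n,
  and a sum of such bounds diverges. It becomes summable because one decomposition of F, made at one
  scale, serves all smaller scales with the same L. This couples the levels: for each j only O(j +
  1) of them can have weighted measure at least exp (-j), and the series of (j + 1) exp (-j)
  converges.

  The scales fit because a piece of the boundary of length \<rho> corresponds to a half-disc of area
  of order \<rho>^2; hence the cut at measure \<rho>^2. The concentrated part of F has no pointwise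
  bound close to the boundary point, only an L^2 bound along the line, so level sets are treated by
  averaging over them.

  The boundary is unbounded, and the set where the function is nonzero may have infinite length.
  Small values are therefore controlled by an L^2 bound, and only levels n \<ge> 1 are
  summed.\<close>

lemma borel_upper_half_plane [measurable]: "upper_half_plane \<in> sets borel"
proof -
  have "upper_half_plane = {p. snd p > 0}" by (auto simp: upper_half_plane_def)
  also have "\<dots> \<in> sets borel"
    by (intro borel_open open_Collect_less continuous_intros)
  finally show ?thesis .
qed

text \<open>\<open>1 / (1 + s^2)\<close> is the density of the angle \<open>arctan s\<close>; the
  total mass is the opening angle of the half-plane.\<close>

lemma nn_integral_inverse_1_plus_square:
  "(\<integral>\<^sup>+s. ennreal (1 / (1 + s\<^sup>2)) \<partial>lborel) = ennreal pi"
proof -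
  have m[measurable]: "(\<lambda>s::real. 1 / (1 + s\<^sup>2)) \<in> borel_measurable borel" by measurable
  have half: "(\<integral>\<^sup>+s. ennreal (1 / (1 + s\<^sup>2)) * indicator {0..} s \<partial>lborel) = ennreal (pi / 2)"
  proof (subst nn_integral_FTC_atLeast[where F = arctan and T = "pi / 2"])
    show "(arctan has_real_derivative 1 / (1 + x\<^sup>2)) (at x)" for x
      by (auto intro!: derivative_eq_intros simp: field_simps)
    show "(arctan \<longlongrightarrow> pi / 2) at_top" by (rule tendsto_arctan_at_top)
  qed auto
  have "(\<integral>\<^sup>+s. ennreal (1 / (1 + s\<^sup>2)) \<partial>lborel) =
      (\<integral>\<^sup>+s. ennreal (1 / (1 + s\<^sup>2)) * indicator {0..} s
           + ennreal (1 / (1 + s\<^sup>2)) * indicator {..0} s \<partial>lborel)"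
    by (intro nn_integral_cong_AE AE_I[where N = "{0}"]) (auto split: split_indicator)
  also have "\<dots> = (\<integral>\<^sup>+s. ennreal (1 / (1 + s\<^sup>2)) * indicator {0..} s \<partial>lborel) +
      (\<integral>\<^sup>+s. ennreal (1 / (1 + s\<^sup>2)) * indicator {..0} s \<partial>lborel)"
    by (rule nn_integral_add) auto
  also have "(\<integral>\<^sup>+s. ennreal (1 / (1 + s\<^sup>2)) * indicator {..0} s \<partial>lborel) =
      (\<integral>\<^sup>+s. ennreal (1 / (1 + s\<^sup>2)) * indicator {0..} s \<partial>lborel)"
    by (subst nn_integral_real_affine[where c = "-1" and t = 0])
       (auto intro!: nn_integral_cong split: split_indicator)
  also have "\<dots> + \<dots> = ennreal pi"
    unfolding half by (simp flip: ennreal_plus)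
  finally show ?thesis by (simp add: half)
qed

text \<open>
  Polar coordinates centred at a boundary point, with the direction given by the slope
  \<open>s = (x - z) / y\<close> instead of an angle: only one-dimensional affine substitutions are needed.
\<close>

lemma nn_integral_polar:
  fixes H :: "real \<times> real \<Rightarrow> ennreal"
  assumes [measurable]: "H \<in> borel_measurable borel"
  shows "(\<integral>\<^sup>+p. H p * indicator upper_half_plane p \<partial>lborel) =
    (\<integral>\<^sup>+s. ennreal (1 / (1 + s\<^sup>2)) * (\<integral>\<^sup>+r. ennreal r * indicator {0<..} r *
        H (z + r * (s / sqrt (1 + s\<^sup>2)), r / sqrt (1 + s\<^sup>2)) \<partial>lborel) \<partial>lborel)"
proof -
  have [measurable]: "H \<in> borel_measurable (borel \<Otimes>\<^sub>M borel)"
    by (simp add: borel_prod)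
  have "(\<integral>\<^sup>+p. H p * indicator upper_half_plane p \<partial>lborel) =
      (\<integral>\<^sup>+p. H p * indicator upper_half_plane p \<partial>(lborel \<Otimes>\<^sub>M lborel))"
    by (simp add: lborel_prod)
  also have "\<dots> = (\<integral>\<^sup>+y. (\<integral>\<^sup>+x. H (x, y) * indicator upper_half_plane (x, y) \<partial>lborel) \<partial>lborel)"
    by (subst lborel_pair.nn_integral_snd[symmetric]) (auto simp: lborel_prod)
  also have "\<dots> = (\<integral>\<^sup>+y. indicator {0<..} y * (\<integral>\<^sup>+s. ennreal y * H (z + y * s, y) \<partial>lborel) \<partial>lborel)"
  proof (rule nn_integral_cong)
    fix y :: real
    show "(\<integral>\<^sup>+x. H (x, y) * indicator upper_half_plane (x, y) \<partial>lborel) =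
        indicator {0<..} y * (\<integral>\<^sup>+s. ennreal y * H (z + y * s, y) \<partial>lborel)"
    proof (cases "y > 0")
      case True
      have "(\<integral>\<^sup>+x. H (x, y) \<partial>lborel) = ennreal \<bar>y\<bar> * (\<integral>\<^sup>+s. H (z + y * s, y) \<partial>lborel)"
        using True by (intro nn_integral_real_affine) auto
      with True show ?thesis
        by (simp add: upper_half_plane_def nn_integral_cmult)
    qed (simp add: upper_half_plane_def)
  qed
  also have "\<dots> = (\<integral>\<^sup>+y. (\<integral>\<^sup>+s. indicator {0<..} y * (ennreal y * H (z + y * s, y)) \<partial>lborel) \<partial>lborel)"
    by (subst nn_integral_cmult) auto
  also have "\<dots> = (\<integral>\<^sup>+s. (\<integral>\<^sup>+y. indicator {0<..} y * (ennreal y * H (z + y * s, y)) \<partial>lborel) \<partial>lborel)"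
    by (subst lborel_pair.Fubini') auto
  also have "\<dots> = (\<integral>\<^sup>+s. ennreal (1 / (1 + s\<^sup>2)) * (\<integral>\<^sup>+r. ennreal r * indicator {0<..} r *
        H (z + r * (s / sqrt (1 + s\<^sup>2)), r / sqrt (1 + s\<^sup>2)) \<partial>lborel) \<partial>lborel)"
  proof (rule nn_integral_cong)
    fix s :: real
    \<comment> \<open>The substitution \<open>y = c * r\<close> contributes the Jacobian
      \<open>c\<close>, and the factor \<open>y\<close> left by the substitution in x becomes
      \<open>c * r\<close>; together they give \<open>r / (1 + s^2)\<close>.\<close>
    define c where "c = 1 / sqrt (1 + s\<^sup>2)"
    have "1 + s\<^sup>2 > 0" by (simp add: add_pos_nonneg)
    then have c: "c > 0" "c * c = 1 / (1 + s\<^sup>2)" by (auto simp: c_def)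
    have "(\<integral>\<^sup>+y. indicator {0<..} y * (ennreal y * H (z + y * s, y)) \<partial>lborel) =
      ennreal \<bar>c\<bar> * (\<integral>\<^sup>+r. indicator {0<..} (0 + c * r) * (ennreal (0 + c * r)
          * H (z + (0 + c * r) * s, 0 + c * r)) \<partial>lborel)"
      using c by (intro nn_integral_real_affine) auto
    also have "(\<integral>\<^sup>+r. indicator {0<..} (0 + c * r) * (ennreal (0 + c * r)
          * H (z + (0 + c * r) * s, 0 + c * r)) \<partial>lborel) =
        (\<integral>\<^sup>+r. ennreal c * (ennreal r * indicator {0<..} r * H (z + r * (s * c), r * c)) \<partial>lborel)"
      using c by (intro nn_integral_cong)
        (auto split: split_indicator simp: ennreal_mult zero_less_mult_iff mult_ac)
    also have "\<dots> = ennreal c * (\<integral>\<^sup>+r. (ennreal r * indicator {0<..} r * H (z + r * (s * c), r * c)) \<partial>lborel)"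
      by (subst nn_integral_cmult) auto
    finally show "(\<integral>\<^sup>+y. indicator {0<..} y * (ennreal y * H (z + y * s, y)) \<partial>lborel) =
      ennreal (1 / (1 + s\<^sup>2)) * (\<integral>\<^sup>+r. ennreal r * indicator {0<..} r *
        H (z + r * (s / sqrt (1 + s\<^sup>2)), r / sqrt (1 + s\<^sup>2)) \<partial>lborel)"
      using c by (simp add: c_def[symmetric] flip: mult.assoc ennreal_mult)
         (simp add: c_def)
  qed
  finally show ?thesis .
qed

lemma dist_polar:
  assumes "r \<ge> 0"
  shows "dist (z + r * (s / sqrt (1 + s\<^sup>2)), r / sqrt (1 + s\<^sup>2)) (z, 0 :: real) = r"
proof -
  have p: "1 + s\<^sup>2 > 0" by (simp add: add_pos_nonneg)
  have "(dist (z + r * (s / sqrt (1 + s\<^sup>2)), r / sqrt (1 + s\<^sup>2)) (z, 0 :: real))\<^sup>2 =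
      r\<^sup>2 * ((s\<^sup>2 + 1) / (1 + s\<^sup>2))"
    using p by (simp add: dist_prod_def dist_real_def power_mult_distrib power_divide
        add_divide_distrib distrib_left)
  also have "\<dots> = r\<^sup>2" using p by (simp add: add.commute)
  finally show ?thesis using assms by (simp add: power2_eq_iff_nonneg)
qed

lemma nn_integral_polar_radial:
  fixes h :: "real \<Rightarrow> ennreal"
  assumes [measurable]: "h \<in> borel_measurable borel"
  shows "(\<integral>\<^sup>+p. h (dist p (z, 0)) * indicator upper_half_plane p \<partial>lborel) =
    ennreal pi * (\<integral>\<^sup>+r. ennreal r * indicator {0<..} r * h r \<partial>lborel)"
proof -
  have [measurable]: "(\<lambda>p::real\<times>real. h (dist p (z, 0))) \<in> borel_measurable borel"
    by (intro measurable_compose[OF _ assms] borel_measurable_continuous_onI continuous_intros)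
  have "(\<integral>\<^sup>+p. h (dist p (z, 0)) * indicator upper_half_plane p \<partial>lborel) =
     (\<integral>\<^sup>+s. ennreal (1 / (1 + s\<^sup>2)) * (\<integral>\<^sup>+r. ennreal r * indicator {0<..} r *
        h (dist (z + r * (s / sqrt (1 + s\<^sup>2)), r / sqrt (1 + s\<^sup>2)) (z, 0)) \<partial>lborel) \<partial>lborel)"
    by (rule nn_integral_polar) measurable
  also have "\<dots> = (\<integral>\<^sup>+s. ennreal (1 / (1 + s\<^sup>2)) *
      (\<integral>\<^sup>+r. ennreal r * indicator {0<..} r * h r \<partial>lborel) \<partial>lborel)"
    by (intro nn_integral_cong, rule arg_cong[where f = "(*) _"], intro nn_integral_cong)
       (simp add: indicator_def dist_polar del: times_divide_eq_right)
  also have "\<dots> = ennreal pi * (\<integral>\<^sup>+r. ennreal r * indicator {0<..} r * h r \<partial>lborel)"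
    by (subst nn_integral_multc) (auto simp: nn_integral_inverse_1_plus_square)
  finally show ?thesis .
qed

section \<open>The annulus potential\<close>

lemma nn_integral_inverse_Ico:
  assumes "0 < a" "a \<le> b"
  shows "(\<integral>\<^sup>+r. ennreal (1 / r) * indicator {a..<b} r \<partial>lborel) = ennreal (ln (b / a))"
proof -
  have "(\<integral>\<^sup>+r. ennreal (1 / r) * indicator {a..<b} r \<partial>lborel) =
      (\<integral>\<^sup>+r. ennreal (1 / r) * indicator {a..b} r \<partial>lborel)"
    by (intro nn_integral_cong_AE AE_I[where N = "{b}"]) (auto split: split_indicator)
  also have "\<dots> = ennreal (ln b - ln a)"
    using assms by (intro nn_integral_FTC_Icc) (auto intro!: derivative_eq_intros simp: field_simps)
  finally show ?thesis using assms by (simp add: ln_div)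
qed

lemma nn_integral_inverse_sqrt:
  assumes "0 \<le> b"
  shows "(\<integral>\<^sup>+r. ennreal (1 / sqrt r) * indicator {0<..<b} r \<partial>lborel) = ennreal (2 * sqrt b)"
proof -
  have "((\<lambda>x. x powr (-1/2)) has_integral (b powr (-1/2+1) / (-1/2+1))) {0..b}"
    using assms by (intro has_integral_powr_from_0) auto
  then have "(\<integral>\<^sup>+r. ennreal (r powr (-1/2)) * indicator {0..b} r \<partial>lborel) = ennreal (b powr (1/2) / (1/2))"
    by (intro nn_integral_has_integral_lebesgue') auto
  moreover have "(\<integral>\<^sup>+r. ennreal (1 / sqrt r) * indicator {0<..<b} r \<partial>lborel) =
      (\<integral>\<^sup>+r. ennreal (r powr (-1/2)) * indicator {0..b} r \<partial>lborel)"
    by (intro nn_integral_cong_AE AE_I[where N = "{0, b}"])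
       (auto split: split_indicator simp: powr_minus_divide powr_half_sqrt emeasure_lborel_countable)
  ultimately show ?thesis using assms by (simp add: powr_half_sqrt mult.commute)
qed

text \<open>Half-open annuli fit together without overlap, as \<open>potential_split\<close> needs.
  With the half-plane built into the kernel, values of F elsewhere have no influence. The factor
  1/\<pi> of the representation formula is left out.\<close>

definition annulus_kernel :: "real \<Rightarrow> real \<Rightarrow> real \<Rightarrow> real \<times> real \<Rightarrow> ennreal" where
  "annulus_kernel a b z p = indicator upper_half_plane p *
     (indicator {a..<b} (dist p (z, 0)) * ennreal (1 / dist p (z, 0)))"

definition potential :: "real \<Rightarrow> real \<Rightarrow> (real \<times> real \<Rightarrow> ennreal) \<Rightarrow> real \<Rightarrow> ennreal" where
  "potential a b F z = (\<integral>\<^sup>+p. F p * annulus_kernel a b z p \<partial>lborel)"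

lemma borel_measurable_dist_fst [measurable]:
  "(\<lambda>(z, p). dist p (z, 0)) \<in> borel_measurable (borel \<Otimes>\<^sub>M (borel :: (real \<times> real) measure))"
  unfolding borel_prod split_beta by (intro borel_measurable_continuous_onI continuous_intros)

lemma measurable_annulus_kernel' [measurable]:
  "(\<lambda>(z, p). annulus_kernel a b z p) \<in> borel_measurable (borel \<Otimes>\<^sub>M borel)"
  unfolding annulus_kernel_def split_beta by measurable

lemma measurable_annulus_kernel [measurable]:
  "annulus_kernel a b z \<in> borel_measurable borel"
  unfolding annulus_kernel_def[abs_def] by measurable

lemma measurable_potential [measurable]:
  assumes [measurable]: "F \<in> borel_measurable borel"
  shows "potential a b F \<in> borel_measurable borel"
  unfolding potential_def[abs_def] by measurable

lemma potential_mono: "(\<And>p. F p \<le> G p) \<Longrightarrow> potential a b F z \<le> potential a b G z"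
  unfolding potential_def by (intro nn_integral_mono mult_right_mono) auto

lemma potential_add:
  assumes [measurable]: "F \<in> borel_measurable borel" "G \<in> borel_measurable borel"
  shows "potential a b (\<lambda>p. F p + G p) z = potential a b F z + potential a b G z"
  unfolding potential_def distrib_right by (rule nn_integral_add) auto

lemma potential_split:
  assumes [measurable]: "F \<in> borel_measurable borel" and "a \<le> b" "b \<le> c"
  shows "potential a c F z = potential a b F z + potential b c F z"
proof -
  have "annulus_kernel a c z p = annulus_kernel a b z p + annulus_kernel b c z p" for p
    using assms by (auto simp: annulus_kernel_def split: split_indicator)
  then show ?thesis
    unfolding potential_def by (simp add: distrib_left nn_integral_add)
qed

lemma nn_integral_annulus_kernel:
  assumes "0 \<le> b"
  shows "(\<integral>\<^sup>+p. annulus_kernel 0 b z p \<partial>lborel) = ennreal (pi * b)"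
proof -
  have "(\<integral>\<^sup>+p. annulus_kernel 0 b z p \<partial>lborel) =
     (\<integral>\<^sup>+p. indicator {0..<b} (dist p (z, 0)) * ennreal (1 / dist p (z, 0)) *
        indicator upper_half_plane p \<partial>lborel)"
    by (simp add: annulus_kernel_def mult_ac)
  also have "\<dots> = ennreal pi * (\<integral>\<^sup>+r. ennreal r * indicator {0<..} r * (indicator {0..<b} r * ennreal (1 / r)) \<partial>lborel)"
    by (rule nn_integral_polar_radial) measurable
  also have "(\<integral>\<^sup>+r. ennreal r * indicator {0<..} r * (indicator {0..<b} r * ennreal (1 / r)) \<partial>lborel) =
      (\<integral>\<^sup>+r. indicator {0<..<b} r \<partial>lborel)"
    by (intro nn_integral_cong) (auto split: split_indicator simp flip: ennreal_mult)
  also have "ennreal pi * \<dots> = ennreal (pi * b)"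
    using assms by (simp add: ennreal_mult)
  finally show ?thesis .
qed

lemma nn_integral_annulus_kernel_square:
  assumes "0 < a" "a \<le> b"
  shows "(\<integral>\<^sup>+p. (annulus_kernel a b z p)\<^sup>2 \<partial>lborel) = ennreal (pi * ln (b / a))"
proof -
  have "(\<integral>\<^sup>+p. (annulus_kernel a b z p)\<^sup>2 \<partial>lborel) =
     (\<integral>\<^sup>+p. indicator {a..<b} (dist p (z, 0)) * ennreal (1 / dist p (z, 0))^2 *
        indicator upper_half_plane p \<partial>lborel)"
    by (intro nn_integral_cong) (auto simp: annulus_kernel_def split: split_indicator)
  also have "\<dots> = ennreal pi * (\<integral>\<^sup>+r. ennreal r * indicator {0<..} r * (indicator {a..<b} r * (ennreal (1 / r))^2) \<partial>lborel)"
    by (rule nn_integral_polar_radial) measurable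
  also have "(\<integral>\<^sup>+r. ennreal r * indicator {0<..} r * (indicator {a..<b} r * (ennreal (1 / r))^2) \<partial>lborel) =
      (\<integral>\<^sup>+r. ennreal (1 / r) * indicator {a..<b} r \<partial>lborel)"
    using assms by (intro nn_integral_cong)
      (auto split: split_indicator simp: ennreal_power power2_eq_square simp flip: ennreal_mult)
  also have "ennreal pi * \<dots> = ennreal (pi * ln (b / a))"
    using assms by (simp add: nn_integral_inverse_Ico ennreal_mult)
  finally show ?thesis .
qed

lemma potential_annulus_le:
  assumes [measurable]: "F \<in> borel_measurable borel" and "0 < a" "a \<le> b"
  shows "(potential a b F z)\<^sup>2 \<le> (\<integral>\<^sup>+p. (F p)\<^sup>2 \<partial>lborel) * ennreal (pi * ln (b / a))"
  unfolding potential_def nn_integral_annulus_kernel_square[OF assms(2,3), of z, symmetric]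
  by (rule Cauchy_Schwarz_nn_integral) auto

text \<open>
  Schur's test with the weight \<open>dist p (z, 0) powr (-1/4)\<close>.
\<close>

lemma nn_integral_potential_square_le:
  assumes [measurable]: "F \<in> borel_measurable borel" and b: "0 \<le> b"
  shows "(\<integral>\<^sup>+z. (potential 0 b F z)\<^sup>2 \<partial>lborel) \<le> ennreal (8 * pi * b) * (\<integral>\<^sup>+p. (F p)\<^sup>2 \<partial>lborel)"
proof -
  define k where "k z p = indicator {0..<b} (dist p (z, 0)) * ennreal (1 / sqrt (dist p (z, 0)))"
    for z :: real and p :: "real \<times> real"
  have k_measurable [measurable]: "(\<lambda>(z, p). k z p) \<in> borel_measurable (borel \<Otimes>\<^sub>M borel)"
    unfolding k_def split_beta by measurable
  have [measurable]: "k z \<in> borel_measurable borel" for z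
    unfolding k_def[abs_def] by measurable
  have pointwise: "(potential 0 b F z)\<^sup>2 \<le> (\<integral>\<^sup>+p. (F p)\<^sup>2 * indicator upper_half_plane p * k z p \<partial>lborel) * ennreal (2 * pi * sqrt b)"
    for z
  proof -
    let ?r = "\<lambda>p. dist p (z, 0 :: real)"
    \<comment> \<open>With r the distance, 1/r is split into \<open>r powr (-1/4)\<close> and
      \<open>r powr (-3/4)\<close>. Their squares have exponents -1/2, integrable in z along the
      line, and -3/2, integrable in p over the half-disc.\<close>
    let ?f = "\<lambda>p. F p * indicator upper_half_plane p * (indicator {0..<b} (?r p) * ennreal (1 / sqrt (sqrt (?r p))))"
    let ?g = "\<lambda>p. indicator upper_half_plane p * (indicator {0..<b} (?r p) * ennreal (1 / (sqrt (?r p) * sqrt (sqrt (?r p)))))"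
    have "potential 0 b F z = (\<integral>\<^sup>+p. ?f p * ?g p \<partial>lborel)"
      unfolding potential_def annulus_kernel_def
    proof (intro nn_integral_cong)
      fix p
      have "1 / sqrt (sqrt (?r p)) * (1 / (sqrt (?r p) * sqrt (sqrt (?r p)))) = 1 / ?r p"
        by (simp add: mult_ac flip: mult.assoc)
      then have "ennreal (1 / ?r p) = ennreal (1 / sqrt (sqrt (?r p))) * ennreal (1 / (sqrt (?r p) * sqrt (sqrt (?r p))))"
        by (simp flip: ennreal_mult)
      then show "F p * (indicator upper_half_plane p * (indicator {0..<b} (?r p) * ennreal (1 / ?r p))) = ?f p * ?g p"
        by (auto split: split_indicator simp: mult_ac)
    qed
    then have "(potential 0 b F z)\<^sup>2 = (\<integral>\<^sup>+p. ?f p * ?g p \<partial>lborel)\<^sup>2" by simp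
    also have "\<dots> \<le> (\<integral>\<^sup>+p. (?f p)\<^sup>2 \<partial>lborel) * (\<integral>\<^sup>+p. (?g p)\<^sup>2 \<partial>lborel)"
      by (rule Cauchy_Schwarz_nn_integral) measurable
    also have "(\<integral>\<^sup>+p. (?f p)\<^sup>2 \<partial>lborel) = (\<integral>\<^sup>+p. (F p)\<^sup>2 * indicator upper_half_plane p * k z p \<partial>lborel)"
      by (intro nn_integral_cong)
         (auto simp: k_def power_mult_distrib ennreal_power power_divide split: split_indicator)
    also have "(\<integral>\<^sup>+p. (?g p)\<^sup>2 \<partial>lborel) =
        (\<integral>\<^sup>+p. indicator {0..<b} (?r p) * ennreal (1 / (?r p * sqrt (?r p))) * indicator upper_half_plane p \<partial>lborel)"
      by (intro nn_integral_cong)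
         (auto simp: power_mult_distrib ennreal_power power_divide split: split_indicator)
    also have "\<dots> = ennreal pi * (\<integral>\<^sup>+r. ennreal r * indicator {0<..} r * (indicator {0..<b} r * ennreal (1 / (r * sqrt r))) \<partial>lborel)"
      by (rule nn_integral_polar_radial) measurable
    also have "(\<integral>\<^sup>+r. ennreal r * indicator {0<..} r * (indicator {0..<b} r * ennreal (1 / (r * sqrt r))) \<partial>lborel)
       = (\<integral>\<^sup>+r. ennreal (1 / sqrt r) * indicator {0<..<b} r \<partial>lborel)"
      by (intro nn_integral_cong) (auto split: split_indicator simp flip: ennreal_mult)
    also have "ennreal pi * \<dots> = ennreal (2 * pi * sqrt b)"
      using b by (simp add: nn_integral_inverse_sqrt ennreal_mult mult_ac)
    finally show ?thesis .
  qed
  have k_le: "(\<integral>\<^sup>+z. k z p \<partial>lborel) \<le> ennreal (4 * sqrt b)" for p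
  proof -
    obtain x y where p: "p = (x, y)" by (cases p)
    have "(\<integral>\<^sup>+z. k z p \<partial>lborel) \<le>
      (\<integral>\<^sup>+z. ennreal (1 / sqrt (z - x)) * indicator {0<..<b} (z - x)
           + ennreal (1 / sqrt (x - z)) * indicator {0<..<b} (x - z) \<partial>lborel)"
    \<comment> \<open>The weight decreases with the distance, which is at least
      \<open>\<bar>z - x\<bar>\<close>. At \<open>z = x\<close> both open indicators on the right
      vanish, so this point has to be excepted.\<close>
    proof (intro nn_integral_mono_AE AE_I[where N = "{x}"])
      show "{z \<in> space lborel. \<not> (k z p \<le> ennreal (1 / sqrt (z - x)) * indicator {0<..<b} (z - x)
           + ennreal (1 / sqrt (x - z)) * indicator {0<..<b} (x - z))} \<subseteq> {x}"
      proof safe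
        fix z assume *: "\<not> (k z p \<le> ennreal (1 / sqrt (z - x)) * indicator {0<..<b} (z - x)
           + ennreal (1 / sqrt (x - z)) * indicator {0<..<b} (x - z))"
        show "z = x"
        proof (rule ccontr)
          assume "z \<noteq> x"
          have d: "\<bar>z - x\<bar> \<le> dist p (z, 0)"
            using dist_fst_le[of p "(z, 0)"] by (simp add: p dist_real_def abs_minus_commute)
          have "0 < \<bar>z - x\<bar>" using \<open>z \<noteq> x\<close> by simp
          then have "0 < dist p (z, 0)" using d by linarith
          then have "0 < sqrt (dist p (z, 0)) * sqrt \<bar>z - x\<bar>"
            using \<open>0 < \<bar>z - x\<bar>\<close> by simp
          then have "k z p \<le> indicator {0<..<b} \<bar>z - x\<bar> * ennreal (1 / sqrt \<bar>z - x\<bar>)"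
            using d \<open>z \<noteq> x\<close> by (auto simp: k_def split: split_indicator intro!: ennreal_leI divide_left_mono)
          also have "\<dots> \<le> ennreal (1 / sqrt (z - x)) * indicator {0<..<b} (z - x)
             + ennreal (1 / sqrt (x - z)) * indicator {0<..<b} (x - z)"
            by (auto split: split_indicator simp: abs_if)
          finally show False using * by simp
        qed
      qed
    qed auto
    also have "\<dots> = (\<integral>\<^sup>+z. ennreal (1 / sqrt (z - x)) * indicator {0<..<b} (z - x) \<partial>lborel) +
           (\<integral>\<^sup>+z. ennreal (1 / sqrt (x - z)) * indicator {0<..<b} (x - z) \<partial>lborel)"
      by (rule nn_integral_add) auto
    also have "(\<integral>\<^sup>+z. ennreal (1 / sqrt (z - x)) * indicator {0<..<b} (z - x) \<partial>lborel) =
        (\<integral>\<^sup>+z. ennreal (1 / sqrt z) * indicator {0<..<b} z \<partial>lborel)"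
      by (subst nn_integral_real_affine[where c = 1 and t = x]) auto
    also have "(\<integral>\<^sup>+z. ennreal (1 / sqrt (x - z)) * indicator {0<..<b} (x - z) \<partial>lborel) =
        (\<integral>\<^sup>+z. ennreal (1 / sqrt z) * indicator {0<..<b} z \<partial>lborel)"
      by (subst nn_integral_real_affine[where c = "-1" and t = x]) auto
    finally show ?thesis
      using b by (simp add: nn_integral_inverse_sqrt flip: ennreal_plus)
  qed
  have "(\<integral>\<^sup>+z. (potential 0 b F z)\<^sup>2 \<partial>lborel) \<le>
     (\<integral>\<^sup>+z. (\<integral>\<^sup>+p. (F p)\<^sup>2 * indicator upper_half_plane p * k z p \<partial>lborel) * ennreal (2 * pi * sqrt b) \<partial>lborel)"
    by (intro nn_integral_mono pointwise)
  also have "\<dots> = (\<integral>\<^sup>+z. (\<integral>\<^sup>+p. (F p)\<^sup>2 * indicator upper_half_plane p * k z p \<partial>lborel) \<partial>lborel) * ennreal (2 * pi * sqrt b)"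
    by (rule nn_integral_multc) measurable
  also have "(\<integral>\<^sup>+z. (\<integral>\<^sup>+p. (F p)\<^sup>2 * indicator upper_half_plane p * k z p \<partial>lborel) \<partial>lborel) =
      (\<integral>\<^sup>+p. (\<integral>\<^sup>+z. (F p)\<^sup>2 * indicator upper_half_plane p * k z p \<partial>lborel) \<partial>lborel)"
    by (rule lborel_pair.Fubini') measurable
  also have "\<dots> \<le> (\<integral>\<^sup>+p. (F p)\<^sup>2 * ennreal (4 * sqrt b) \<partial>lborel)"
  proof (intro nn_integral_mono)
    fix p
    have "(\<integral>\<^sup>+z. (F p)\<^sup>2 * indicator upper_half_plane p * k z p \<partial>lborel) =
        (F p)\<^sup>2 * indicator upper_half_plane p * (\<integral>\<^sup>+z. k z p \<partial>lborel)"
      by (rule nn_integral_cmult) measurable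
    also have "\<dots> \<le> (F p)\<^sup>2 * indicator upper_half_plane p * ennreal (4 * sqrt b)"
      by (intro mult_left_mono k_le) auto
    also have "\<dots> \<le> (F p)\<^sup>2 * ennreal (4 * sqrt b)"
      by (auto split: split_indicator)
    finally show "(\<integral>\<^sup>+z. (F p)\<^sup>2 * indicator upper_half_plane p * k z p \<partial>lborel) \<le> (F p)\<^sup>2 * ennreal (4 * sqrt b)" .
  qed
  also have "\<dots> = (\<integral>\<^sup>+p. (F p)\<^sup>2 \<partial>lborel) * ennreal (4 * sqrt b)"
    by (rule nn_integral_multc) measurable
  also have "\<dots> * ennreal (2 * pi * sqrt b) = (\<integral>\<^sup>+p. (F p)\<^sup>2 \<partial>lborel) * ennreal (4 * sqrt b * (2 * pi * sqrt b))"
    using b by (subst (3) ennreal_mult) (auto simp: mult.assoc)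
  also have "4 * sqrt b * (2 * pi * sqrt b) = 8 * pi * b"
    using b by simp
  finally show ?thesis
    by (simp add: mult_right_mono mult.commute)
qed

section \<open>Estimates on level sets\<close>

lemma ennreal_square_le_iff: "0 \<le> y \<Longrightarrow> x\<^sup>2 \<le> ennreal (y\<^sup>2) \<longleftrightarrow> x \<le> ennreal y"
  by (cases x) (auto simp: ennreal_power power2_le_iff_abs_le top_unique power_eq_top_ennreal)

text \<open>
  A superlevel set of \<open>F\<close> of measure \<open>m\<close>; the weight \<open>\<theta>\<close> is fractional on \<open>{F = \<tau>}\<close>, where
  \<open>F\<close> may have a plateau.
\<close>

lemma superlevel_weight:
  fixes F :: "'a \<Rightarrow> real"
  assumes [measurable]: "F \<in> borel_measurable M" and nonneg: "\<And>x. 0 \<le> F x"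
    and fin: "(\<integral>\<^sup>+x. ennreal ((F x)\<^sup>2) \<partial>M) \<le> 1" and m: "m > 0"
  obtains \<theta> :: "'a \<Rightarrow> real" and \<tau> :: real where "\<theta> \<in> borel_measurable M" "\<And>x. 0 \<le> \<theta> x" "\<And>x. \<theta> x \<le> 1"
    "0 \<le> \<tau>" "\<And>x. (1 - \<theta> x) * F x \<le> \<tau>"
    "(\<integral>\<^sup>+x. ennreal (\<theta> x) \<partial>M) \<le> ennreal m"
    "ennreal (\<tau>\<^sup>2 * m) \<le> (\<integral>\<^sup>+x. ennreal (\<theta> x * (F x)\<^sup>2) \<partial>M)"
proof -
  define \<mu> where "\<mu> s = emeasure M {x \<in> space M. s < F x}" for s
  have mono: "\<mu> t \<le> \<mu> s" if "s \<le> t" for s t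
    unfolding \<mu>_def using that by (intro emeasure_mono) auto
  have cheb: "\<mu> s \<le> ennreal (1 / s\<^sup>2)" if "s > 0" for s
  proof -
    have "\<mu> s = (\<integral>\<^sup>+x. indicator {x \<in> space M. s < F x} x \<partial>M)"
      unfolding \<mu>_def by (rule nn_integral_indicator[symmetric]) measurable
    also have "\<dots> \<le> (\<integral>\<^sup>+x. ennreal (1 / s\<^sup>2) * ennreal ((F x)\<^sup>2) \<partial>M)"
      using that
      by (intro nn_integral_mono)
         (auto simp: power_mono ennreal_1[symmetric] simp del: ennreal_1 split: split_indicator simp flip: ennreal_mult)
    also have "\<dots> = ennreal (1 / s\<^sup>2) * (\<integral>\<^sup>+x. ennreal ((F x)\<^sup>2) \<partial>M)"
      by (rule nn_integral_cmult) measurable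
    also have "\<dots> \<le> ennreal (1 / s\<^sup>2) * 1"
      by (intro mult_left_mono fin) auto
    finally show ?thesis by simp
  qed
  define S where "S = {s. 0 \<le> s \<and> \<mu> s \<le> ennreal m}"
  have "1 / sqrt m \<in> S"
    using cheb[of "1 / sqrt m"] m by (simp add: S_def power_divide)
  then have S: "S \<noteq> {}" "bdd_below S" by (blast, auto simp: S_def intro: bdd_belowI)
  define \<tau> where "\<tau> = Inf S"
  have \<tau>: "0 \<le> \<tau>"
    unfolding \<tau>_def using S by (intro cInf_greatest) (auto simp: S_def)
  have above: "\<mu> s \<le> ennreal m" if s: "\<tau> < s" for s
  proof -
    obtain s' where "s' \<in> S" "s' < s"
      using cInf_lessD[OF S(1), of s] s unfolding \<tau>_def by blast
    then show ?thesis using mono[of s' s] by (auto simp: S_def)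
  qed
  have le: "\<mu> \<tau> \<le> ennreal m"
  proof -
    have "\<mu> \<tau> = emeasure M (\<Union>n::nat. {x \<in> space M. \<tau> + 1 / Suc n < F x})"
      unfolding \<mu>_def
    proof (intro arg_cong2[where f = emeasure] refl set_eqI iffI)
      fix x assume x: "x \<in> {x \<in> space M. \<tau> < F x}"
      then obtain n :: nat where "inverse (real (Suc n)) < F x - \<tau>"
        using reals_Archimedean[of "F x - \<tau>"] by auto
      then have "\<tau> + 1 / Suc n < F x" by (simp add: inverse_eq_divide)
      with x show "x \<in> (\<Union>n::nat. {x \<in> space M. \<tau> + 1 / Suc n < F x})" by blast
    next
      fix x assume "x \<in> (\<Union>n::nat. {x \<in> space M. \<tau> + 1 / Suc n < F x})"
      then obtain n :: nat where "x \<in> space M" "\<tau> + 1 / Suc n < F x" by blast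
      moreover have "\<tau> < \<tau> + 1 / Suc n" by simp
      ultimately show "x \<in> {x \<in> space M. \<tau> < F x}" by (blast intro: order.strict_trans)
    qed
    also have "\<dots> = (SUP n. \<mu> (\<tau> + 1 / Suc n))"
      unfolding \<mu>_def
    proof (intro SUP_emeasure_incseq[symmetric])
      have "\<tau> + 1 / Suc j \<le> \<tau> + 1 / Suc i" if "i \<le> j" for i j
        using that by (intro add_left_mono divide_left_mono) auto
      then show "incseq (\<lambda>n. {x \<in> space M. \<tau> + 1 / Suc n < F x})"
        unfolding incseq_def by (blast intro: order.strict_trans1)
    qed auto
    also have "\<dots> \<le> ennreal m"
      by (intro SUP_least above) (simp del: of_nat_Suc)
    finally show ?thesis .
  qed
  show ?thesis
  \<comment> \<open>If \<open>\<tau> = 0\<close>, the set where F is positive already has measure at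
    most m, and the energy bound is trivial.\<close>
  proof (cases "\<tau> = 0")
    case True
    show ?thesis
    proof (rule that[of "\<lambda>x. if 0 < F x then 1 else 0" 0])
      have "(\<integral>\<^sup>+x. ennreal (if 0 < F x then 1 else 0) \<partial>M) = (\<integral>\<^sup>+x. indicator {x \<in> space M. 0 < F x} x \<partial>M)"
        by (intro nn_integral_cong) (auto split: split_indicator)
      then show "(\<integral>\<^sup>+x. ennreal (if 0 < F x then 1 else 0) \<partial>M) \<le> ennreal m"
        using le by (simp add: True \<mu>_def)
    qed (use nonneg in \<open>auto simp: not_less\<close>)
  next
    case False
    with \<tau> have pos: "0 < \<tau>" by simp
    have ge: "ennreal m \<le> emeasure M {x \<in> space M. \<tau> \<le> F x}"
    proof -
      \<comment> \<open>Levels increasing to \<open>\<tau>\<close>; the \<open>n + 2\<close> keeps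
        the first one positive, so that Chebyshev's inequality supplies the finiteness that
        continuity from above requires. Lying below the infimum, none of them belongs to
        \<open>S\<close>.\<close>
      let ?s = "\<lambda>n::nat. \<tau> - \<tau> / (n + 2)"
      have s: "0 < ?s n" "?s n < \<tau>" for n using pos by (auto simp: field_simps intro: add_pos_nonneg)
      have fin: "\<mu> (?s n) < \<infinity>" for n
        using cheb[OF s(1)[of n]] by (rule order.strict_trans1) simp
      have "emeasure M {x \<in> space M. \<tau> \<le> F x} = emeasure M (\<Inter>n. {x \<in> space M. ?s n < F x})"
      proof (intro arg_cong2[where f = emeasure] refl set_eqI iffI)
        fix x assume "x \<in> {x \<in> space M. \<tau> \<le> F x}"
        then show "x \<in> (\<Inter>n. {x \<in> space M. ?s n < F x})"
          using s(2) by (blast intro: order.strict_trans2)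
      next
        fix x assume x: "x \<in> (\<Inter>n. {x \<in> space M. ?s n < F x})"
        have "\<tau> \<le> F x"
        proof (rule LIMSEQ_le_const2)
          show "?s \<longlonglongrightarrow> \<tau>" by real_asymp
          show "\<exists>N. \<forall>n\<ge>N. ?s n \<le> F x" using x by (auto intro!: less_imp_le)
        qed
        with x show "x \<in> {x \<in> space M. \<tau> \<le> F x}" by auto
      qed
      also have "\<dots> = (INF n. \<mu> (?s n))"
        unfolding \<mu>_def
      proof (intro INF_emeasure_decseq[symmetric])
        have "?s i \<le> ?s j" if "i \<le> j" for i j
          using that pos by (intro diff_left_mono divide_left_mono) auto
        then show "decseq (\<lambda>n. {x \<in> space M. ?s n < F x})"
          unfolding decseq_def by (blast intro: order.strict_trans1)
        show "emeasure M {x \<in> space M. ?s n < F x} \<noteq> \<infinity>" for n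
          using fin[of n] by (simp add: \<mu>_def)
      qed auto
      also have "\<dots> \<ge> ennreal m"
      proof (rule INF_greatest)
        fix n
        have "?s n \<notin> S" using s(2)[of n] cInf_lower[OF _ S(2), of "?s n"] by (auto simp: \<tau>_def)
        then show "ennreal m \<le> \<mu> (?s n)" using s(1)[of n] by (auto simp: S_def)
      qed
      finally show ?thesis .
    qed
    define A where "A = {x \<in> space M. \<tau> < F x}"
    define B where "B = {x \<in> space M. \<tau> = F x}"
    have [measurable]: "A \<in> sets M" "B \<in> sets M" by (auto simp: A_def B_def)
    have AB: "A \<inter> B = {}" "A \<union> B = {x \<in> space M. \<tau> \<le> F x}" by (auto simp: A_def B_def)
    have "emeasure M {x \<in> space M. \<tau> \<le> F x} \<le> \<mu> (\<tau> / 2)"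
      unfolding \<mu>_def using pos by (intro emeasure_mono) auto
    also have "\<dots> < \<infinity>"
      using cheb[of "\<tau> / 2"] pos by (auto intro: order.strict_trans1)
    finally have finAB: "emeasure M (A \<union> B) < \<infinity>" by (simp add: AB)
    have "emeasure M A \<le> emeasure M (A \<union> B)" "emeasure M B \<le> emeasure M (A \<union> B)"
      by (intro emeasure_mono; simp)+
    then have finA: "emeasure M A \<noteq> \<infinity>" and finB: "emeasure M B \<noteq> \<infinity>" using finAB by auto
    define a where "a = measure M A"
    define b where "b = measure M B"
    have a: "emeasure M A = ennreal a" "0 \<le> a" and b: "emeasure M B = ennreal b" "0 \<le> b"
      using finA finB by (auto simp: a_def b_def emeasure_eq_ennreal_measure)
    have am: "a \<le> m" using le m by (simp add: \<mu>_def A_def[symmetric] a)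
    have "emeasure M (A \<union> B) = ennreal (a + b)"
      using AB(1) a b by (subst plus_emeasure[symmetric]) auto
    then have mab: "m \<le> a + b" using ge a(2) b(2) by (simp add: AB del: ennreal_plus)
    \<comment> \<open>The plateau supplies the missing measure \<open>m - a\<close>. If
      \<open>b = 0\<close>, the quotient is 0 by convention, and then \<open>a = m\<close>
      already.\<close>
    define \<kappa> where "\<kappa> = (m - a) / b"
    have \<kappa>: "0 \<le> \<kappa>" "\<kappa> \<le> 1" "a + \<kappa> * b = m"
      using am mab b(2) by (auto simp: \<kappa>_def divide_le_eq)
    define \<theta> where "\<theta> x = (if \<tau> < F x then 1 else if \<tau> = F x then \<kappa> else 0)" for x
    have [measurable]: "\<theta> \<in> borel_measurable M"
      unfolding \<theta>_def by measurable
    have int: "(\<integral>\<^sup>+x. ennreal (\<theta> x) \<partial>M) = ennreal m"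
    proof -
      have "(\<integral>\<^sup>+x. ennreal (\<theta> x) \<partial>M) = (\<integral>\<^sup>+x. indicator A x + ennreal \<kappa> * indicator B x \<partial>M)"
        using \<kappa> by (intro nn_integral_cong) (auto simp: \<theta>_def A_def B_def split: split_indicator)
      also have "\<dots> = ennreal a + ennreal \<kappa> * ennreal b"
        by (subst nn_integral_add) (auto simp: nn_integral_cmult a b)
      also have "\<dots> = ennreal m"
        using \<kappa> a b by (simp flip: ennreal_mult ennreal_plus)
      finally show ?thesis .
    qed
    show ?thesis
    proof (rule that[of \<theta> \<tau>])
      have "ennreal (\<tau>\<^sup>2 * m) = (\<integral>\<^sup>+x. ennreal (\<tau>\<^sup>2) * ennreal (\<theta> x) \<partial>M)"
        using m by (subst nn_integral_cmult) (auto simp: int ennreal_mult)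
      also have "\<dots> \<le> (\<integral>\<^sup>+x. ennreal (\<theta> x * (F x)\<^sup>2) \<partial>M)"
        using \<kappa> pos
        by (intro nn_integral_mono)
           (auto simp: \<theta>_def power_mono simp flip: ennreal_mult intro!: ennreal_leI)
      finally show "ennreal (\<tau>\<^sup>2 * m) \<le> (\<integral>\<^sup>+x. ennreal (\<theta> x * (F x)\<^sup>2) \<partial>M)" .
      show "(1 - \<theta> x) * F x \<le> \<tau>" for x
        using \<kappa> pos nonneg[of x]
        by (auto simp: \<theta>_def intro: mult_left_le_one_le)
    qed (use \<kappa> \<tau> int in \<open>auto simp: \<theta>_def\<close>)
  qed
qed


lemma nn_integral_set_le_sqrt:
  assumes [measurable]: "f \<in> borel_measurable M" "E \<in> sets M" and "emeasure M E = ennreal e"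
    and "(\<integral>\<^sup>+x. (f x)\<^sup>2 \<partial>M) \<le> ennreal c" "0 \<le> e" "0 \<le> c"
  shows "(\<integral>\<^sup>+x. f x * indicator E x \<partial>M) \<le> ennreal (sqrt (c * e))"
proof -
  have "(\<integral>\<^sup>+x. f x * indicator E x \<partial>M)\<^sup>2 \<le> (\<integral>\<^sup>+x. (f x)\<^sup>2 \<partial>M) * (\<integral>\<^sup>+x. (indicator E x)\<^sup>2 \<partial>M)"
    by (rule Cauchy_Schwarz_nn_integral) auto
  also have "(\<integral>\<^sup>+x. (indicator E x :: ennreal)\<^sup>2 \<partial>M) = (\<integral>\<^sup>+x. indicator E x \<partial>M)"
    by (intro nn_integral_cong) (auto split: split_indicator)
  also have "\<dots> = ennreal e" using assms by simp
  also have "(\<integral>\<^sup>+x. (f x)\<^sup>2 \<partial>M) * ennreal e \<le> ennreal c * ennreal e"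
    using assms by (intro mult_right_mono) auto
  also have "\<dots> = ennreal ((sqrt (c * e))\<^sup>2)" using assms by (simp add: ennreal_mult)
  finally show ?thesis using assms by (subst (asm) ennreal_square_le_iff) auto
qed

text \<open>F is split into \<open>G = (1 - \<theta>) F\<close>, bounded by \<tau>, and
  \<open>H = \<theta> F\<close>, concentrated on small mass; L^2 is the energy assigned to H.
  Logarithms come only from G beyond \<rho>1 and from H between \<rho>2 and \<rho>1. The other three
  pieces are multiples of L, collected in the 6. As L depends on F and \<rho>1 alone, one value
  serves all \<rho>2 and E.\<close>

lemma Adams_level_set_estimate:
  fixes F :: "real \<times> real \<Rightarrow> real"
  assumes [measurable]: "F \<in> borel_measurable borel" and nonneg: "\<And>p. 0 \<le> F p"
    and fin: "(\<integral>\<^sup>+p. ennreal ((F p)\<^sup>2) \<partial>lborel) \<le> 1"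
    and \<rho>1: "0 < \<rho>1" "\<rho>1 \<le> 1"
  obtains L where "0 \<le> L" "L \<le> 1"
    "\<And>\<rho>2 E c. 0 < \<rho>2 \<Longrightarrow> \<rho>2 \<le> \<rho>1 \<Longrightarrow> E \<in> sets borel \<Longrightarrow> ennreal \<rho>2 \<le> emeasure lborel E \<Longrightarrow>
       emeasure lborel E < \<infinity> \<Longrightarrow>
       (\<And>z. z \<in> E \<Longrightarrow> ennreal (pi * c) \<le> potential 0 (pi / 2) (\<lambda>p. ennreal (F p)) z) \<Longrightarrow>
       sqrt pi * c \<le> sqrt (ln (1 / \<rho>1) + 1) * sqrt (1 - L\<^sup>2) + L * (sqrt (ln (\<rho>1 / \<rho>2)) + 6)"
proof -
  obtain \<theta> :: "real \<times> real \<Rightarrow> real" and \<tau> where [measurable]: "\<theta> \<in> borel_measurable borel"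
    and \<theta>: "\<And>x. 0 \<le> \<theta> x" "\<And>x. \<theta> x \<le> 1"
    and \<tau>: "0 \<le> \<tau>" "\<And>x. (1 - \<theta> x) * F x \<le> \<tau>"
    and mass: "(\<integral>\<^sup>+x. ennreal (\<theta> x) \<partial>lborel) \<le> ennreal (\<rho>1\<^sup>2)"
    and energy: "ennreal (\<tau>\<^sup>2 * \<rho>1\<^sup>2) \<le> (\<integral>\<^sup>+x. ennreal (\<theta> x * (F x)\<^sup>2) \<partial>lborel)"
  proof (rule superlevel_weight[of F lborel "\<rho>1\<^sup>2"])
  qed (use nonneg fin \<rho>1 in auto)
  define e where "e = (\<integral>\<^sup>+x. ennreal (\<theta> x * (F x)\<^sup>2) \<partial>lborel)"
  have "e \<le> (\<integral>\<^sup>+p. ennreal ((F p)\<^sup>2) \<partial>lborel)"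
    unfolding e_def using \<theta> by (intro nn_integral_mono ennreal_leI mult_left_le_one_le) auto
  also note fin
  finally have e1: "e \<le> 1" .
  define L where "L = sqrt (enn2real e)"
  have "e < top" using e1 by (rule order.strict_trans1) simp
  then have L: "0 \<le> L" "e = ennreal (L\<^sup>2)" by (auto simp: L_def)
  have L1: "L \<le> 1" using e1 L(1) by (simp add: L(2) power_le_one_iff abs_square_le_1)
  have \<tau>L: "\<tau> * \<rho>1 \<le> L"
  proof -
    have "(\<tau> * \<rho>1)\<^sup>2 \<le> L\<^sup>2"
      using energy unfolding e_def[symmetric] L(2) by (simp add: power_mult_distrib)
    then show ?thesis using L(1) by (rule power2_le_imp_le)
  qed
  define G where "G p = ennreal ((1 - \<theta> p) * F p)" for p
  define H where "H p = ennreal (\<theta> p * F p)" for p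
  have [measurable]: "G \<in> borel_measurable borel" "H \<in> borel_measurable borel"
    by (auto simp: G_def[abs_def] H_def[abs_def])
  have GH: "ennreal (F p) = G p + H p" for p
    using \<theta>[of p] nonneg[of p]
    by (simp add: G_def H_def flip: ennreal_plus) (simp add: algebra_simps)
  have H2: "(\<integral>\<^sup>+p. (H p)\<^sup>2 \<partial>lborel) \<le> ennreal (L\<^sup>2)"
    unfolding L(2)[symmetric] e_def
  proof (rule nn_integral_mono)
    fix p
    have "(\<theta> p * F p)\<^sup>2 = \<theta> p * \<theta> p * (F p)\<^sup>2" by (simp add: power2_eq_square)
    also have "\<dots> \<le> \<theta> p * (F p)\<^sup>2"
      using \<theta>[of p] by (intro mult_right_mono mult_left_le_one_le) auto
    finally show "(H p)\<^sup>2 \<le> ennreal (\<theta> p * (F p)\<^sup>2)"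
      using \<theta>[of p] nonneg[of p] by (simp add: H_def ennreal_power ennreal_leI)
  qed
  \<comment> \<open>The full amount L^2 can be subtracted because
    \<open>(1 - \<theta>)^2 + \<theta> \<le> 1\<close>.\<close>
  have G2: "(\<integral>\<^sup>+p. (G p)\<^sup>2 \<partial>lborel) \<le> ennreal (1 - L\<^sup>2)"
  proof -
    have "(\<integral>\<^sup>+p. (G p)\<^sup>2 \<partial>lborel) + e \<le> (\<integral>\<^sup>+p. ennreal ((F p)\<^sup>2) \<partial>lborel)"
      unfolding e_def
    proof (subst nn_integral_add[symmetric], simp, simp, rule nn_integral_mono)
      fix p
      have "((1 - \<theta> p) * F p)\<^sup>2 + \<theta> p * (F p)\<^sup>2 = (F p)\<^sup>2 - (1 - \<theta> p) * \<theta> p * (F p)\<^sup>2"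
        by (simp add: algebra_simps power2_eq_square)
      also have "\<dots> \<le> (F p)\<^sup>2" using \<theta>[of p] by simp
      finally show "(G p)\<^sup>2 + ennreal (\<theta> p * (F p)\<^sup>2) \<le> ennreal ((F p)\<^sup>2)"
        using \<theta>[of p] nonneg[of p] by (simp add: G_def ennreal_power flip: ennreal_plus)
    qed
    also note fin
    finally have le: "(\<integral>\<^sup>+p. (G p)\<^sup>2 \<partial>lborel) + ennreal (L\<^sup>2) \<le> 1" by (simp add: L(2))
    then have "(\<integral>\<^sup>+p. (G p)\<^sup>2 \<partial>lborel) \<noteq> top" by (auto simp: top_unique)
    with le show ?thesis
      by (cases "\<integral>\<^sup>+p. (G p)\<^sup>2 \<partial>lborel") (auto simp flip: ennreal_plus simp: ennreal_1[symmetric] simp del: ennreal_1)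
  qed
  have P1: "potential \<rho>1 (pi / 2) G z \<le> ennreal (sqrt (1 - L\<^sup>2) * sqrt (pi * (ln (1 / \<rho>1) + 1)))" for z
  proof -
    have "ln (pi / 2 / \<rho>1) = ln (1 / \<rho>1) + ln (pi / 2)"
      using \<rho>1 by (simp add: ln_div ln_mult)
    also have "ln (pi / 2) \<le> pi / 2 - 1" by (rule ln_le_minus_one) simp
    also have "\<dots> \<le> 1" using pi_less_4 by simp
    finally have ln: "ln (pi / 2 / \<rho>1) \<le> ln (1 / \<rho>1) + 1" by simp
    have ge: "0 \<le> ln (1 / \<rho>1)" using \<rho>1 by simp
    have "(potential \<rho>1 (pi / 2) G z)\<^sup>2 \<le> (\<integral>\<^sup>+p. (G p)\<^sup>2 \<partial>lborel) * ennreal (pi * ln (pi / 2 / \<rho>1))"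
      using \<rho>1 pi_ge_two by (intro potential_annulus_le) auto
    also have "\<dots> \<le> ennreal (1 - L\<^sup>2) * ennreal (pi * (ln (1 / \<rho>1) + 1))"
      by (rule mult_mono[OF G2 ennreal_leI[OF mult_left_mono[OF ln]]]) auto
    also have "\<dots> = ennreal ((sqrt (1 - L\<^sup>2) * sqrt (pi * (ln (1 / \<rho>1) + 1)))\<^sup>2)"
      using L L1 ge by (simp add: ennreal_mult power_mult_distrib power_le_one)
    finally show ?thesis using L L1 ge by (subst (asm) ennreal_square_le_iff) (auto simp: power_le_one)
  qed
  \<comment> \<open>Close to z the height of G counts: it is at most \<tau>, the kernel has mass
    \<open>pi * \<rho>1\<close>, and \<open>\<tau> * \<rho>1 \<le> L\<close>.\<close>
  have P2: "potential 0 \<rho>1 G z \<le> ennreal (pi * L)" for z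
  proof -
    have "potential 0 \<rho>1 G z \<le> potential 0 \<rho>1 (\<lambda>_. ennreal \<tau>) z"
      unfolding G_def by (intro potential_mono ennreal_leI \<tau>)
    also have "\<dots> = ennreal \<tau> * ennreal (pi * \<rho>1)"
      unfolding potential_def using \<rho>1 by (simp add: nn_integral_cmult nn_integral_annulus_kernel)
    also have "\<dots> = ennreal (pi * (\<tau> * \<rho>1))"
      using \<tau>(1) \<rho>1 by (simp add: mult_ac flip: ennreal_mult)
    also have "\<dots> \<le> ennreal (pi * L)" using \<tau>L by (intro ennreal_leI) auto
    finally show ?thesis .
  qed
  \<comment> \<open>Far from z the kernel is at most \<open>1 / \<rho>1\<close>, while mass
    \<open>\<rho>1^2\<close> and energy L^2 bound the integral of H by
    \<open>\<rho>1 * L\<close>.\<close>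
  have P3: "potential \<rho>1 (pi / 2) H z \<le> ennreal L" for z
  proof -
    have "potential \<rho>1 (pi / 2) H z \<le> (\<integral>\<^sup>+p. H p * ennreal (1 / \<rho>1) \<partial>lborel)"
      unfolding potential_def annulus_kernel_def using \<rho>1
      by (intro nn_integral_mono mult_left_mono) (auto split: split_indicator intro!: ennreal_leI frac_le)
    also have "\<dots> = (\<integral>\<^sup>+p. H p \<partial>lborel) * ennreal (1 / \<rho>1)"
      by (rule nn_integral_multc) measurable
    also have "(\<integral>\<^sup>+p. H p \<partial>lborel) = (\<integral>\<^sup>+p. ennreal (sqrt (\<theta> p)) * ennreal (sqrt (\<theta> p) * F p) \<partial>lborel)"
      using \<theta> nonneg by (intro nn_integral_cong) (simp add: H_def flip: ennreal_mult mult.assoc)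
    also have "\<dots> \<le> ennreal (\<rho>1 * L)"
    proof -
      have "(\<integral>\<^sup>+p. ennreal (sqrt (\<theta> p)) * ennreal (sqrt (\<theta> p) * F p) \<partial>lborel)\<^sup>2
        \<le> (\<integral>\<^sup>+p. (ennreal (sqrt (\<theta> p)))\<^sup>2 \<partial>lborel) * (\<integral>\<^sup>+p. (ennreal (sqrt (\<theta> p) * F p))\<^sup>2 \<partial>lborel)"
        by (rule Cauchy_Schwarz_nn_integral) measurable
      also have "\<dots> = (\<integral>\<^sup>+x. ennreal (\<theta> x) \<partial>lborel) * e"
        unfolding e_def using \<theta> nonneg by (simp add: ennreal_power power_mult_distrib)
      also have "\<dots> \<le> ennreal (\<rho>1\<^sup>2) * ennreal (L\<^sup>2)"
        unfolding L(2) by (intro mult_right_mono mass) auto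
      also have "\<dots> = ennreal ((\<rho>1 * L)\<^sup>2)"
        by (simp add: power_mult_distrib flip: ennreal_mult)
      finally show ?thesis using L \<rho>1 by (subst (asm) ennreal_square_le_iff) auto
    qed
    finally show ?thesis using \<rho>1 L
      by (simp add: mult_right_mono flip: ennreal_mult)
  qed
  have P4: "potential \<rho>2 \<rho>1 H z \<le> ennreal (L * sqrt (pi * ln (\<rho>1 / \<rho>2)))" if "0 < \<rho>2" "\<rho>2 \<le> \<rho>1" for z \<rho>2
  proof -
    have ge: "0 \<le> ln (\<rho>1 / \<rho>2)" using that by simp
    have "(potential \<rho>2 \<rho>1 H z)\<^sup>2 \<le> (\<integral>\<^sup>+p. (H p)\<^sup>2 \<partial>lborel) * ennreal (pi * ln (\<rho>1 / \<rho>2))"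
      using that by (intro potential_annulus_le) auto
    also have "\<dots> \<le> ennreal (L\<^sup>2) * ennreal (pi * ln (\<rho>1 / \<rho>2))"
      by (intro mult_right_mono H2) auto
    also have "\<dots> = ennreal ((L * sqrt (pi * ln (\<rho>1 / \<rho>2)))\<^sup>2)"
      using L ge by (simp add: power_mult_distrib flip: ennreal_mult)
    finally show ?thesis using L ge by (subst (asm) ennreal_square_le_iff) auto
  qed
  show ?thesis
  proof (rule that[OF L(1) L1])
    fix \<rho>2 c :: real and E :: "real set"
    assume \<rho>2: "0 < \<rho>2" "\<rho>2 \<le> \<rho>1" and [measurable]: "E \<in> sets borel"
      and E: "ennreal \<rho>2 \<le> emeasure lborel E" "emeasure lborel E < \<infinity>"
      and c: "\<And>z. z \<in> E \<Longrightarrow> ennreal (pi * c) \<le> potential 0 (pi / 2) (\<lambda>p. ennreal (F p)) z"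
    show "sqrt pi * c \<le> sqrt (ln (1 / \<rho>1) + 1) * sqrt (1 - L\<^sup>2) + L * (sqrt (ln (\<rho>1 / \<rho>2)) + 6)"
      (is "_ \<le> ?rhs")
    proof (cases "0 \<le> c")
      case False
      then have "sqrt pi * c \<le> 0" by (simp add: mult_nonneg_nonpos)
      also have "0 \<le> ?rhs" using L L1 \<rho>1 \<rho>2 by (auto simp: power_le_one intro!: add_nonneg_nonneg mult_nonneg_nonneg)
      finally show ?thesis .
    next
      case True
      define m where "m = measure lborel E"
      have m: "emeasure lborel E = ennreal m" using E(2) by (simp add: m_def emeasure_eq_ennreal_measure)
      have m_ge: "\<rho>2 \<le> m" using E(1) \<rho>2(1) unfolding m by (simp add: m_def)
      with \<rho>2 have m0: "0 < m" by simp
      define K where "K = sqrt (1 - L\<^sup>2) * sqrt (pi * (ln (1 / \<rho>1) + 1)) + pi * L + L + L * sqrt (pi * ln (\<rho>1 / \<rho>2))"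
      have K: "0 \<le> K"
        unfolding K_def using L L1 \<rho>1 \<rho>2 by (auto simp: power_le_one intro!: add_nonneg_nonneg mult_nonneg_nonneg)
      have pt: "ennreal (pi * c) \<le> ennreal K + potential 0 \<rho>2 H z" if "z \<in> E" for z
      proof -
        have "ennreal (pi * c) \<le> potential 0 (pi / 2) (\<lambda>p. ennreal (F p)) z" using that by (rule c)
        also have "\<dots> = potential 0 (pi / 2) G z + potential 0 (pi / 2) H z"
          unfolding GH by (rule potential_add) measurable
        also have "potential 0 (pi / 2) G z = potential 0 \<rho>1 G z + potential \<rho>1 (pi / 2) G z"
          using \<rho>1 pi_ge_two by (intro potential_split) auto
        also have "potential 0 (pi / 2) H z = potential 0 \<rho>1 H z + potential \<rho>1 (pi / 2) H z"
          using \<rho>1 pi_ge_two by (intro potential_split) auto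
        also have "potential 0 \<rho>1 H z = potential 0 \<rho>2 H z + potential \<rho>2 \<rho>1 H z"
          using \<rho>2 by (intro potential_split) auto
        also have "potential 0 \<rho>1 G z + potential \<rho>1 (pi / 2) G z
           + (potential 0 \<rho>2 H z + potential \<rho>2 \<rho>1 H z + potential \<rho>1 (pi / 2) H z) \<le>
           ennreal (pi * L) + ennreal (sqrt (1 - L\<^sup>2) * sqrt (pi * (ln (1 / \<rho>1) + 1))) +
           (potential 0 \<rho>2 H z + ennreal (L * sqrt (pi * ln (\<rho>1 / \<rho>2))) + ennreal L)"
          using \<rho>2 by (intro add_mono P1 P2 P3 P4 order_refl)
        also have "\<dots> = ennreal K + potential 0 \<rho>2 H z"
        proof -
          have "ennreal K = ennreal (sqrt (1 - L\<^sup>2) * sqrt (pi * (ln (1 / \<rho>1) + 1))) + ennreal (pi * L) + ennreal L + ennreal (L * sqrt (pi * ln (\<rho>1 / \<rho>2)))"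
            unfolding K_def using L L1 \<rho>1 \<rho>2
            by (subst ennreal_plus[symmetric]; auto simp: power_le_one intro!: add_nonneg_nonneg mult_nonneg_nonneg)+
          then show ?thesis by (simp add: ac_simps)
        qed
        finally show ?thesis .
      qed
      \<comment> \<open>H may be unbounded near z, so this piece is estimated only on average over
        E. The L^2 bound yields \<open>sqrt (\<rho>2 * m)\<close>, and
        \<open>\<rho>2 \<le> m\<close> makes this a multiple of m, of the same order as the other
        terms.\<close>
      have P5: "(\<integral>\<^sup>+z. potential 0 \<rho>2 H z * indicator E z \<partial>lborel) \<le> ennreal (sqrt (8 * pi * \<rho>2 * L\<^sup>2 * m))"
      proof (rule nn_integral_set_le_sqrt)
        have "(\<integral>\<^sup>+z. (potential 0 \<rho>2 H z)\<^sup>2 \<partial>lborel) \<le> ennreal (8 * pi * \<rho>2) * (\<integral>\<^sup>+p. (H p)\<^sup>2 \<partial>lborel)"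
          using \<rho>2 by (intro nn_integral_potential_square_le) auto
        also have "\<dots> \<le> ennreal (8 * pi * \<rho>2) * ennreal (L\<^sup>2)"
          by (intro mult_left_mono H2) auto
        also have "\<dots> = ennreal (8 * pi * \<rho>2 * L\<^sup>2)"
          using \<rho>2 by (subst ennreal_mult) auto
        finally show "(\<integral>\<^sup>+z. (potential 0 \<rho>2 H z)\<^sup>2 \<partial>lborel) \<le> ennreal (8 * pi * \<rho>2 * L\<^sup>2)" .
      qed (use m m0 \<rho>2 in auto)
      have "sqrt (8 * pi * \<rho>2 * L\<^sup>2 * m) \<le> sqrt (8 * pi * m * L\<^sup>2 * m)"
        using m_ge m0 by (intro real_sqrt_le_mono mult_right_mono mult_left_mono) auto
      also have "\<dots> = sqrt 8 * sqrt pi * L * m"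
        using L m0 by (simp add: real_sqrt_mult)
      finally have bound: "sqrt (8 * pi * \<rho>2 * L\<^sup>2 * m) \<le> sqrt 8 * sqrt pi * L * m" .
      have "ennreal (pi * c * m) = (\<integral>\<^sup>+z. ennreal (pi * c) * indicator E z \<partial>lborel)"
        using True m0 m by (simp add: nn_integral_cmult flip: ennreal_mult)
      also have "\<dots> \<le> (\<integral>\<^sup>+z. ennreal K * indicator E z + potential 0 \<rho>2 H z * indicator E z \<partial>lborel)"
        by (intro nn_integral_mono) (auto split: split_indicator intro: pt)
      also have "\<dots> = ennreal K * ennreal m + (\<integral>\<^sup>+z. potential 0 \<rho>2 H z * indicator E z \<partial>lborel)"
        by (subst nn_integral_add) (auto simp: nn_integral_cmult m)
      also have "\<dots> \<le> ennreal K * ennreal m + ennreal (sqrt 8 * sqrt pi * L * m)"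
        by (intro add_left_mono order_trans[OF P5] ennreal_leI bound)
      also have "\<dots> = ennreal (K * m + sqrt 8 * sqrt pi * L * m)"
        using K L m0 by (simp add: ennreal_mult)
      finally have "pi * c * m \<le> K * m + sqrt 8 * sqrt pi * L * m"
        using K L m0 by (subst (asm) ennreal_le_iff) auto
      then have "(pi * c) * m \<le> (K + sqrt 8 * sqrt pi * L) * m" by (simp add: algebra_simps)
      then have "pi * c \<le> K + sqrt 8 * sqrt pi * L" using m0 by simp
      also have "K + sqrt 8 * sqrt pi * L = sqrt pi * (sqrt (ln (1 / \<rho>1) + 1) * sqrt (1 - L\<^sup>2)
         + L * (sqrt (ln (\<rho>1 / \<rho>2)) + (sqrt pi + 1 / sqrt pi + sqrt 8)))"
        unfolding K_def real_sqrt_mult by (simp add: algebra_simps)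
      also have "\<dots> \<le> sqrt pi * ?rhs"
      proof -
        \<comment> \<open>After division by \<open>sqrt pi\<close>, the near part of G, the far part
          of H and the averaged part of H contribute \<open>sqrt pi\<close>,
          \<open>1 / sqrt pi\<close> and \<open>sqrt 8\<close>: at most 2 + 1 + 3.\<close>
        have "sqrt pi \<le> 2" using pi_less_4 by (intro real_le_lsqrt) auto
        moreover have "sqrt pi \<ge> 1" using pi_ge_two by simp
        then have "1 / sqrt pi \<le> 1" by simp
        moreover have "sqrt 8 \<le> 3" by (intro real_le_lsqrt) auto
        ultimately have "sqrt pi + 1 / sqrt pi + sqrt 8 \<le> 6" by linarith
        then show ?thesis using L by (intro mult_left_mono add_left_mono) auto
      qed
      finally have "sqrt pi * (sqrt pi * c) \<le> sqrt pi * ?rhs" by (simp flip: mult.assoc)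
      then show ?thesis by simp
    qed
  qed
qed

section \<open>Summation over levels\<close>

lemma power2_mono_sqrt_le:
  assumes "sqrt a \<le> b" "0 \<le> a"
  shows "a \<le> b\<^sup>2"
  using power_mono[OF assms(1), of 2] assms(2) by simp

text \<open>The case of two equal scales: Cauchy-Schwarz for the vectors (sqrt (t + 1), 6) and (sqrt
  (1 - L^2), L), the second of which is a unit vector. Hence 37 = 1 + 6^2.\<close>

lemma Adams_weak_bound:
  assumes L: "0 \<le> L" "L \<le> 1" and "0 \<le> t" "0 \<le> n"
    and le: "sqrt n \<le> sqrt (t + 1) * sqrt (1 - L\<^sup>2) + L * 6"
  shows "n \<le> t + 37"
proof -
  define x where "x = sqrt (t + 1)"
  define y where "y = sqrt (1 - L\<^sup>2)"
  have "n \<le> (x * y + L * 6)\<^sup>2"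
    using power2_mono_sqrt_le[OF le] assms by (simp add: x_def y_def)
  also have "\<dots> \<le> (x * y + L * 6)\<^sup>2 + (x * L - 6 * y)\<^sup>2" by simp
  also have "\<dots> = (x\<^sup>2 + 36) * (y\<^sup>2 + L\<^sup>2)" by (simp add: power2_eq_square algebra_simps)
  also have "y\<^sup>2 = 1 - L\<^sup>2" using L by (simp add: y_def power_le_one)
  also have "x\<^sup>2 = t + 1" using assms by (simp add: x_def)
  finally show ?thesis by simp
qed

text \<open>
  With \<open>t\<^sub>i = n\<^sub>i + \<kappa>\<close>: the first estimate makes the energy fraction \<open>L\<^sup>2\<close> of order \<open>(1 + \<kappa>) / n1\<close>,
  and with so little energy left the second one cannot reach levels far above \<open>n1\<close>.
\<close>

lemma Adams_gap_bound:
  fixes n1 n2 \<kappa> L :: real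
  assumes L: "0 \<le> L" "L \<le> 1" and "0 \<le> \<kappa>" "n1 \<le> n2" and large: "1744 + 16 * \<kappa> \<le> n1"
    and le1: "sqrt n1 \<le> sqrt (n1 + \<kappa> + 1) * sqrt (1 - L\<^sup>2) + L * 6"
    and le2: "sqrt n2 \<le> sqrt (n1 + \<kappa> + 1) * sqrt (1 - L\<^sup>2) + L * (sqrt (n2 - n1) + 6)"
  shows "n2 - n1 \<le> 2272 + 22 * \<kappa>"
proof -
  define X where "X = sqrt (n1 + \<kappa> + 1)"
  define s where "s = sqrt (1 - L\<^sup>2)"
  \<comment> \<open>\<open>y^2\<close> is the energy L^2 times the logarithm \<open>X^2\<close>. The
    first estimate bounds it independently of n1.\<close>
  define y where "y = L * X"
  define r where "r = sqrt (n2 - n1)"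
  have X: "0 < X" "X\<^sup>2 = n1 + \<kappa> + 1" using assms by (auto simp: X_def)
  have s: "0 \<le> s" "s \<le> 1" "s\<^sup>2 = 1 - L\<^sup>2" using L by (auto simp: s_def power_le_one)
  have r: "0 \<le> r" "r\<^sup>2 = n2 - n1" using assms by (auto simp: r_def)
  have y: "0 \<le> y" using L X by (simp add: y_def)
  have "n1 \<le> (X * s + L * 6)\<^sup>2"
    using power2_mono_sqrt_le[OF le1] assms by (simp add: X_def s_def)
  also have "\<dots> = X\<^sup>2 * s\<^sup>2 + 12 * s * y + 36 * L\<^sup>2"
    by (simp add: power2_eq_square algebra_simps y_def)
  also have "\<dots> \<le> X\<^sup>2 * s\<^sup>2 + 12 * 1 * y + 36 * 1"
    using s y L by (intro add_mono mult_mono) (auto simp: power_le_one)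
  also have "X\<^sup>2 * s\<^sup>2 = X\<^sup>2 - y\<^sup>2" by (simp add: s y_def power_mult_distrib algebra_simps)
  finally have "y\<^sup>2 \<le> 12 * y + 37 + \<kappa>" using X by simp
  moreover have "0 \<le> (y - 12)\<^sup>2" by simp
  then have "24 * y \<le> y\<^sup>2 + 144" by (simp add: power2_eq_square algebra_simps)
  ultimately have y2: "y\<^sup>2 \<le> 218 + 2 * \<kappa>" by linarith
  \<comment> \<open>The threshold on n1 is 8 times the bound on \<open>y^2\<close>, chosen to make
    L^2 small enough for the term \<open>L^2 * (r + 6)^2\<close> to be absorbed.\<close>
  have L2: "L\<^sup>2 \<le> 1 / 8"
  proof -
    have "L\<^sup>2 * X\<^sup>2 = y\<^sup>2" by (simp add: y_def power_mult_distrib)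
    also have "\<dots> \<le> 1 / 8 * X\<^sup>2" using y2 large X assms(3) by simp
    finally show ?thesis using X(1) by simp
  qed
  have "n2 \<le> (X * s + L * (r + 6))\<^sup>2"
    using power2_mono_sqrt_le[OF le2] assms by (simp add: X_def s_def r_def)
  also have "\<dots> \<le> (X * 1 + L * (r + 6))\<^sup>2"
    using X s L r by (intro power_mono add_mono mult_left_mono) auto
  also have "\<dots> = X\<^sup>2 + 2 * y * (r + 6) + L\<^sup>2 * (r + 6)\<^sup>2"
    by (simp add: power2_eq_square algebra_simps y_def)
  also have "L\<^sup>2 * (r + 6)\<^sup>2 \<le> 1 / 8 * (r + 6)\<^sup>2"
    by (intro mult_right_mono L2) auto
  finally have main: "r\<^sup>2 \<le> \<kappa> + 1 + 2 * (y * r) + 12 * y + 1 / 8 * (r + 6)\<^sup>2"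
    using X r by (simp add: algebra_simps)
  \<comment> \<open>The terms \<open>2 * (y * r)\<close> and \<open>1 / 8 * (r + 6)^2\<close> cost
    \<open>r^2 / 4\<close> each, so half of \<open>r^2\<close> survives on the left: 2272 = 2 (1 +
    36 + 9 + 5 * 218) and 22 = 2 (1 + 5 * 2).\<close>
  have "0 \<le> (r - 6)\<^sup>2" by simp
  then have "(r + 6)\<^sup>2 \<le> 2 * r\<^sup>2 + 72" by (simp add: power2_eq_square algebra_simps)
  moreover have "0 \<le> (r - 4 * y)\<^sup>2" by simp
  then have "8 * (y * r) \<le> r\<^sup>2 + 16 * y\<^sup>2" by (simp add: power2_eq_square algebra_simps)
  moreover have "0 \<le> (y - 6)\<^sup>2" by simp
  then have "12 * y \<le> y\<^sup>2 + 36" by (simp add: power2_eq_square algebra_simps)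
  ultimately have "r\<^sup>2 \<le> 2272 + 22 * \<kappa>" using main y2 by argo
  then show ?thesis by (simp add: r)
qed

text \<open>\<open>e n\<close> stands for the measure of \<open>{z. n < \<pi> (v z)\<^sup>2}\<close>, and \<open>\<rho> = exp (- t)\<close>.\<close>

definition Adams_levels :: "(nat \<Rightarrow> real) \<Rightarrow> bool" where
  "Adams_levels e \<longleftrightarrow> (\<forall>n. 0 \<le> e n) \<and> (\<forall>n\<ge>1. e n \<le> 13) \<and>
    (\<forall>t1\<ge>0. \<exists>L. 0 \<le> L \<and> L \<le> 1 \<and> (\<forall>t2\<ge>t1. \<forall>n\<ge>1. exp (- t2) \<le> e n \<longrightarrow>
       sqrt (real n) \<le> sqrt (t1 + 1) * sqrt (1 - L\<^sup>2) + L * (sqrt (t2 - t1) + 6)))"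

lemma Adams_levels_le:
  assumes "Adams_levels e" "n \<ge> 1"
  shows "exp (real n) * e n \<le> 13 * exp 37"
proof (cases "e n = 0")
  case False
  then have pos: "0 < e n" using assms by (auto simp: Adams_levels_def less_le)
  \<comment> \<open>Both scales are \<open>exp (- t)\<close>, normally the measure itself. A measure
    above 1 is replaced by the scale 1, and the bound 13 covers the difference.\<close>
  define t where "t = max 0 (- ln (e n))"
  have t: "0 \<le> t" "exp (- t) \<le> e n"
    using pos by (auto simp: t_def max_def minus_le_iff ln_ge_iff[symmetric])
  then obtain L where L: "0 \<le> L" "L \<le> 1"
    and "sqrt (real n) \<le> sqrt (t + 1) * sqrt (1 - L\<^sup>2) + L * (sqrt (t - t) + 6)"
    using assms unfolding Adams_levels_def by (metis order_refl)
  then have n: "real n \<le> t + 37" using t(1) by (intro Adams_weak_bound[OF L]) auto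
  have "exp t * e n \<le> 13"
    using assms pos by (auto simp: t_def max_def Adams_levels_def exp_minus)
  have "exp (real n) * e n \<le> exp (t + 37) * e n"
    using n pos by (intro mult_right_mono) auto
  also have "\<dots> = (exp t * e n) * exp 37" by (simp add: exp_add)
  also have "\<dots> \<le> 13 * exp 37" by (intro mult_right_mono) (fact, simp)
  finally show ?thesis .
qed simp

text \<open>Apart from the levels below \<open>1744 + 16 * j\<close>, all those counted lie in a
  window of length \<open>2272 + 22 * j\<close> above the smallest, by
  \<open>Adams_gap_bound\<close> with \<open>\<kappa> = j\<close>. Both contributions are linear in
  j.\<close>

lemma Adams_levels_card:
  assumes e: "Adams_levels e"
  shows "card {n \<in> {1..N}. exp (- real j) \<le> exp (real n) * e n} \<le> 5000 * (j + 1)"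
proof -
  let ?J = "{n \<in> {1..N}. exp (- real j) \<le> exp (real n) * e n}"
  define J where "J = {n \<in> ?J. 1744 + 16 * j \<le> n}"
  have J: "n \<ge> 1" "exp (- (real n + real j)) \<le> e n" if "n \<in> ?J" for n
    using that by (auto simp: exp_add exp_minus exp_diff field_simps)
  have sub: "?J \<subseteq> {..<1744 + 16 * j} \<union> J" by (auto simp: J_def)
  have finJ: "finite J" by (simp add: J_def)
  have cardJ: "card J \<le> 2273 + 22 * j"
  proof (cases "J = {}")
    case False
    define n1 where "n1 = Min J"
    have n1: "n1 \<in> J" using False finJ by (simp add: n1_def)
    \<comment> \<open>L is fixed by the smallest level n1, through the scale
      \<open>exp (- (n1 + j))\<close>, and then used for every later n2 with
      \<open>t2 = n2 + j\<close>.\<close>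
    obtain L where L: "0 \<le> L" "L \<le> 1" and le: "\<And>t2 n. t2 \<ge> real n1 + real j \<Longrightarrow> n \<ge> 1 \<Longrightarrow> exp (- t2) \<le> e n \<Longrightarrow>
        sqrt (real n) \<le> sqrt (real n1 + real j + 1) * sqrt (1 - L\<^sup>2) + L * (sqrt (t2 - (real n1 + real j)) + 6)"
      using e unfolding Adams_levels_def by (metis add_nonneg_nonneg of_nat_0_le_iff)
    have "J \<subseteq> {n1..n1 + 2272 + 22 * j}"
    proof
      fix n2 assume n2: "n2 \<in> J"
      then have le12: "n1 \<le> n2" using finJ by (simp add: n1_def)
      have "real n2 - real n1 \<le> 2272 + 22 * real j"
      proof (rule Adams_gap_bound[OF L])
        show "1744 + 16 * real j \<le> real n1" using n1 by (simp add: J_def)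
        show "sqrt n1 \<le> sqrt (real n1 + real j + 1) * sqrt (1 - L\<^sup>2) + L * 6"
          using le[of "real n1 + real j" n1] J[of n1] n1 by (simp add: J_def)
        show "sqrt n2 \<le> sqrt (real n1 + real j + 1) * sqrt (1 - L\<^sup>2) + L * (sqrt (real n2 - real n1) + 6)"
          using le[of "real n2 + real j" n2] J[of n2] n2 le12 by (simp add: J_def)
      qed (use le12 in auto)
      then show "n2 \<in> {n1..n1 + 2272 + 22 * j}" using le12 by simp
    qed
    then have "card J \<le> card {n1..n1 + 2272 + 22 * j}" by (intro card_mono) auto
    then show ?thesis by simp
  qed simp
  have "card ?J \<le> card ({..<1744 + 16 * j} \<union> J)"
    using finJ sub by (intro card_mono) auto
  also have "\<dots> \<le> card {..<1744 + 16 * j} + card J" by (rule card_Un_le)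
  also have "\<dots> \<le> 5000 * (j + 1)" using cardJ by simp
  finally show ?thesis .
qed

text \<open>The terms are grouped by size. The group of size about \<open>exp (- j)\<close> has O(j
  + 1) members, so a convergent series that involves neither e nor N dominates the sum.\<close>

lemma Adams_levels_sum:
  "\<exists>C. \<forall>e N. Adams_levels e \<longrightarrow> (\<Sum>n = 1..N. exp (real n) * e n) \<le> C"
proof -
  define A :: real where "A = 13 * exp 38"
  have sums: "(\<lambda>j. of_nat (Suc j) * exp (- 1) ^ j) sums (1 / (1 - exp (- 1 :: real))\<^sup>2)"
    by (rule geometric_deriv_sums) simp
  let ?S = "\<lambda>j. A * 5000 * (of_nat (Suc j) * exp (- 1 :: real) ^ j)"
  have "(\<Sum>n = 1..N. exp (real n) * e n) \<le> suminf ?S" if e: "Adams_levels e" for e N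
  proof -
    define a where "a n = exp (real n) * e n" for n
    define T where "T = {n \<in> {1..N}. 0 < a n}"
    \<comment> \<open>\<open>nat\<close> sends every term \<open>a n \<ge> 1\<close> to group 0,
      where \<open>Adams_levels_le\<close> bounds it by \<open>13 * exp 37\<close>. In the other
      groups rounding up loses a factor of at most \<open>exp 1\<close>. The constant
      \<open>A\<close> exceeds both.\<close>
    define h where "h n = nat \<lceil>- ln (a n)\<rceil>" for n
    define M where "M = Suc (Max (h ` T))"
    have a: "0 \<le> a n" "n \<ge> 1 \<Longrightarrow> a n \<le> 13 * exp 37" for n
      using e Adams_levels_le[OF e, of n] by (auto simp: a_def Adams_levels_def)
    have T: "finite T" by (simp add: T_def)
    have h: "exp (- real (h n)) \<le> a n" "a n \<le> A * exp (- real (h n))" if "n \<in> T" for n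
    proof -
      have pos: "0 < a n" "n \<ge> 1" using that by (auto simp: T_def)
      have "- ln (a n) \<le> real (h n)" unfolding h_def by linarith
      then have "- real (h n) \<le> ln (a n)" by simp
      then show "exp (- real (h n)) \<le> a n" using pos by (simp add: ln_ge_iff)
      show "a n \<le> A * exp (- real (h n))"
      proof (cases "h n = 0")
        case True
        have "a n \<le> 13 * exp 37" using a pos by simp
        also have "\<dots> \<le> A" by (simp add: A_def)
        finally show ?thesis using True by simp
      next
        case False
        then have "real (h n) \<le> 1 - ln (a n)" unfolding h_def by linarith
        then have "ln (a n) \<le> 1 - real (h n)" by simp
        then have "a n \<le> exp (1 - real (h n))" using pos by (metis exp_le_cancel_iff exp_ln)
        also have "\<dots> = exp 1 * exp (- real (h n))" by (simp flip: exp_add)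
        also have "\<dots> \<le> A * exp (- real (h n))"
        proof (intro mult_right_mono)
          have "exp 1 \<le> (exp 38 :: real)" by simp
          also have "\<dots> \<le> A" by (simp add: A_def)
          finally show "exp 1 \<le> A" .
        qed simp
        finally show ?thesis .
      qed
    qed
    have "(\<Sum>n = 1..N. a n) = (\<Sum>n\<in>T. a n)"
      using a(1) by (intro sum.mono_neutral_right) (auto simp: T_def less_le)
    also have "\<dots> = (\<Sum>j<M. \<Sum>n\<in>{n \<in> T. h n = j}. a n)"
      using T by (intro sum.group[symmetric]) (auto simp: M_def less_Suc_eq_le)
    also have "\<dots> \<le> (\<Sum>j<M. ?S j)"
    proof (intro sum_mono)
      fix j
      have "(\<Sum>n\<in>{n \<in> T. h n = j}. a n) \<le> (\<Sum>n\<in>{n \<in> T. h n = j}. A * exp (- real j))"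
        using h(2) by (intro sum_mono) auto
      also have "\<dots> = real (card {n \<in> T. h n = j}) * (A * exp (- real j))" by simp
      also have "\<dots> \<le> real (5000 * (j + 1)) * (A * exp (- real j))"
      proof (intro mult_right_mono)
        have "card {n \<in> T. h n = j} \<le> card {n \<in> {1..N}. exp (- real j) \<le> exp (real n) * e n}"
          using h(1) by (intro card_mono) (auto simp: T_def a_def)
        also have "\<dots> \<le> 5000 * (j + 1)" by (rule Adams_levels_card[OF e])
        finally show "real (card {n \<in> T. h n = j}) \<le> real (5000 * (j + 1))" by linarith
      qed (simp add: A_def)
      also have "\<dots> = ?S j" by (simp add: exp_of_nat_mult[symmetric] mult_ac)
      finally show "(\<Sum>n\<in>{n \<in> T. h n = j}. a n) \<le> ?S j" .
    qed
    also have "\<dots> \<le> suminf ?S"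
      using sums by (intro sum_le_suminf summable_mult) (auto simp: A_def sums_iff)
    finally show ?thesis by (simp add: a_def)
  qed
  then show ?thesis by blast
qed

text \<open>Where \<open>pi * v^2 \<le> 1\<close> the integrand is at most
  \<open>2 * pi * v^2\<close>, which Schur's bound controls; elsewhere it is dominated by a weighted
  sum of indicators of level sets. The constant consists of these two contributions.\<close>

lemma Adams_exponential:
  obtains C :: real where "C > 0" "\<And>F v. F \<in> borel_measurable borel \<Longrightarrow> (\<And>p. 0 \<le> F p) \<Longrightarrow>
     (\<integral>\<^sup>+p. ennreal ((F p)\<^sup>2) \<partial>lborel) \<le> 1 \<Longrightarrow> v \<in> borel_measurable borel \<Longrightarrow>
     (\<And>z. ennreal (pi * \<bar>v z\<bar>) \<le> potential 0 (pi / 2) (\<lambda>p. ennreal (F p)) z) \<Longrightarrow>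
     (\<integral>\<^sup>+z. ennreal (exp (pi * (v z)\<^sup>2) - 1) \<partial>lborel) \<le> ennreal C"
proof -
  obtain C0 where C0: "\<And>e N. Adams_levels e \<Longrightarrow> (\<Sum>n = 1..N. exp (real n) * e n) \<le> C0"
    using Adams_levels_sum by blast
  define C1 where "C1 = max 0 C0"
  show ?thesis
  proof (rule that[of "8 * pi + exp 1 * C1"])
    show "8 * pi + exp 1 * C1 > 0" by (simp add: C1_def add_pos_nonneg)
    fix F :: "real \<times> real \<Rightarrow> real" and v :: "real \<Rightarrow> real"
    assume [measurable]: "F \<in> borel_measurable borel" "v \<in> borel_measurable borel"
      and nonneg: "\<And>p. 0 \<le> F p" and fin: "(\<integral>\<^sup>+p. ennreal ((F p)\<^sup>2) \<partial>lborel) \<le> 1"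
      and v: "\<And>z. ennreal (pi * \<bar>v z\<bar>) \<le> potential 0 (pi / 2) (\<lambda>p. ennreal (F p)) z"
    \<comment> \<open>The constant is \<open>8 * pi * (pi / 2)\<close> divided by
      \<open>pi^2\<close>.\<close>
    have v2: "(\<integral>\<^sup>+z. ennreal ((v z)\<^sup>2) \<partial>lborel) \<le> ennreal 4"
    proof -
      have "ennreal (pi\<^sup>2) * (\<integral>\<^sup>+z. ennreal ((v z)\<^sup>2) \<partial>lborel) = (\<integral>\<^sup>+z. (ennreal (pi * \<bar>v z\<bar>))\<^sup>2 \<partial>lborel)"
        by (subst nn_integral_cmult[symmetric])
           (auto simp: ennreal_power power_mult_distrib ennreal_mult)
      also have "\<dots> \<le> (\<integral>\<^sup>+z. (potential 0 (pi / 2) (\<lambda>p. ennreal (F p)) z)\<^sup>2 \<partial>lborel)"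
        by (intro nn_integral_mono power_mono_ennreal v)
      also have "\<dots> \<le> ennreal (8 * pi * (pi / 2)) * (\<integral>\<^sup>+p. (ennreal (F p))\<^sup>2 \<partial>lborel)"
        by (rule nn_integral_potential_square_le) auto
      also have "\<dots> \<le> ennreal (8 * pi * (pi / 2)) * 1"
        using fin nonneg by (intro mult_left_mono) (auto simp: ennreal_power)
      also have "\<dots> = ennreal (pi\<^sup>2) * ennreal 4"
        by (subst ennreal_mult[symmetric]) (auto simp: power2_eq_square)
      finally show ?thesis
        by (subst (asm) ennreal_mult_le_mult_iff) auto
    qed
    define E where "E n = {z. real n < pi * (v z)\<^sup>2}" for n :: nat
    have [measurable]: "E n \<in> sets borel" for n
      unfolding E_def by measurable
    \<comment> \<open>Chebyshev's inequality gives \<open>4 * pi\<close>, which is below 13.\<close>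
    have E_le: "emeasure lborel (E n) \<le> ennreal 13" if "n \<ge> 1" for n
    proof -
      have "emeasure lborel (E n) = (\<integral>\<^sup>+z. indicator (E n) z \<partial>lborel)" by simp
      also have "\<dots> \<le> (\<integral>\<^sup>+z. ennreal pi * ennreal ((v z)\<^sup>2) \<partial>lborel)"
        using that by (intro nn_integral_mono)
          (auto simp: E_def ennreal_1[symmetric] simp del: ennreal_1 simp flip: ennreal_mult split: split_indicator intro!: ennreal_leI)
      also have "\<dots> = ennreal pi * (\<integral>\<^sup>+z. ennreal ((v z)\<^sup>2) \<partial>lborel)"
        by (rule nn_integral_cmult) measurable
      also have "\<dots> \<le> ennreal pi * ennreal 4"
        by (intro mult_left_mono v2) auto
      also have "\<dots> \<le> ennreal 13"
        using pi_approx by (subst ennreal_mult[symmetric]) (auto intro!: ennreal_leI simp del: ennreal_numeral)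
      finally show ?thesis .
    qed
    \<comment> \<open>\<open>E 0\<close> may have infinite length, in which case
      \<open>measure\<close> returns 0; so only the indices \<open>n \<ge> 1\<close> are
      meaningful.\<close>
    define e where "e n = measure lborel (E n)" for n
    have e: "emeasure lborel (E n) = ennreal (e n)" if "n \<ge> 1" for n
      using E_le[OF that] unfolding e_def
      by (intro emeasure_eq_ennreal_measure) (auto simp: top_unique)
    have "Adams_levels e"
      unfolding Adams_levels_def
    proof (intro conjI allI impI)
      show "0 \<le> e n" for n by (simp add: e_def)
      show "e n \<le> 13" if "n \<ge> 1" for n
        using E_le[OF that] unfolding e[OF that] by (simp del: ennreal_numeral)
      fix t1 :: real assume t1: "0 \<le> t1"
      from Adams_level_set_estimate[OF _ nonneg fin, of "exp (- t1)"] t1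
      obtain L where L: "0 \<le> L" "L \<le> 1" and est:
        "\<And>\<rho>2 E c. 0 < \<rho>2 \<Longrightarrow> \<rho>2 \<le> exp (- t1) \<Longrightarrow> E \<in> sets borel \<Longrightarrow> ennreal \<rho>2 \<le> emeasure lborel E \<Longrightarrow>
          emeasure lborel E < \<infinity> \<Longrightarrow>
          (\<And>z. z \<in> E \<Longrightarrow> ennreal (pi * c) \<le> potential 0 (pi / 2) (\<lambda>p. ennreal (F p)) z) \<Longrightarrow>
          sqrt pi * c \<le> sqrt (ln (1 / exp (- t1)) + 1) * sqrt (1 - L\<^sup>2) + L * (sqrt (ln (exp (- t1) / \<rho>2)) + 6)"
        by auto
      have "sqrt (real n) \<le> sqrt (t1 + 1) * sqrt (1 - L\<^sup>2) + L * (sqrt (t2 - t1) + 6)"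
        if t2: "t1 \<le> t2" and n: "1 \<le> n" and le: "exp (- t2) \<le> e n" for t2 n
      proof -
        \<comment> \<open>On \<open>E n\<close> the value \<open>\<bar>v z\<bar>\<close> is at least
          \<open>sqrt (n / pi)\<close>, which serves as c. Multiplied by \<open>sqrt pi\<close> it
          is \<open>sqrt n\<close>: this is where the exponent \<pi> fits exactly.\<close>
        have "sqrt pi * sqrt (n / pi) \<le> sqrt (ln (1 / exp (- t1)) + 1) * sqrt (1 - L\<^sup>2) + L * (sqrt (ln (exp (- t1) / exp (- t2))) + 6)"
        proof (rule est[of _ "E n"])
          fix z assume "z \<in> E n"
          then have "n / pi \<le> (v z)\<^sup>2" by (simp add: E_def field_simps)
          then have "sqrt (n / pi) \<le> \<bar>v z\<bar>" by (metis real_sqrt_abs real_sqrt_le_mono)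
          then have "ennreal (pi * sqrt (n / pi)) \<le> ennreal (pi * \<bar>v z\<bar>)"
            by (intro ennreal_leI mult_left_mono) auto
          also note v[of z]
          finally show "ennreal (pi * sqrt (n / pi)) \<le> potential 0 (pi / 2) (\<lambda>p. ennreal (F p)) z" .
        qed (use t2 le e[OF n] in \<open>auto intro: ennreal_leI\<close>)
        moreover have "sqrt pi * sqrt (n / pi) = sqrt n" by (simp flip: real_sqrt_mult)
        moreover have "ln (exp (- t1) / exp (- t2)) = t2 - t1" by (simp flip: exp_diff)
        moreover have "ln (1 / exp (- t1)) = t1" by (simp add: ln_div)
        ultimately show ?thesis by simp
      qed
      with L show "\<exists>L. 0 \<le> L \<and> L \<le> 1 \<and> (\<forall>t2\<ge>t1. \<forall>n\<ge>1. exp (- t2) \<le> e n \<longrightarrow>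
         sqrt (real n) \<le> sqrt (t1 + 1) * sqrt (1 - L\<^sup>2) + L * (sqrt (t2 - t1) + 6))"
        by blast
    qed
    then have sum: "(\<Sum>n = 1..N. exp (real n) * e n) \<le> C1" for N
      using C0[of e N] by (simp add: C1_def)
    have pointwise: "ennreal (exp (pi * (v z)\<^sup>2) - 1) \<le> ennreal (2 * pi) * ennreal ((v z)\<^sup>2)
        + (\<Sum>n. ennreal (exp (real n + 2)) * indicator (E (n + 1)) z)" for z
    proof (cases "pi * (v z)\<^sup>2 \<le> 1")
      case True
      define w where "w = pi * (v z)\<^sup>2"
      have "exp w \<le> 1 + w + w\<^sup>2"
        using True by (intro exp_bound) (auto simp: w_def)
      also have "w\<^sup>2 \<le> w" using True by (simp add: w_def power2_eq_square mult_left_le_one_le)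
      finally have "exp w - 1 \<le> 2 * pi * (v z)\<^sup>2" by (simp add: w_def)
      then have "ennreal (exp (pi * (v z)\<^sup>2) - 1) \<le> ennreal (2 * pi) * ennreal ((v z)\<^sup>2)"
        by (simp add: w_def ennreal_leI flip: ennreal_mult)
      then show ?thesis by (rule order_trans) simp
    next
      case False
      define w where "w = pi * (v z)\<^sup>2"
      \<comment> \<open>\<open>n + 2\<close> is the ceiling of w, so z lies in
        \<open>E (n + 1)\<close> and a single term of the series suffices. The offset between the
        two indices is the origin of the factor \<open>exp 1\<close>.\<close>
      define n where "n = nat (\<lceil>w\<rceil> - 2)"
      have n: "real n + 1 < w" "w \<le> real n + 2"
        using False unfolding n_def w_def[symmetric] by linarith+
      have "exp w \<le> exp (real n + 2)" using n by simp
      then have "ennreal (exp w - 1) \<le> ennreal (exp (real n + 2))"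
        by (intro ennreal_leI) linarith
      also have "\<dots> = (\<Sum>k\<in>{n}. ennreal (exp (real k + 2)) * indicator (E (k + 1)) z)"
        using n by (simp add: E_def w_def)
      also have "\<dots> \<le> (\<Sum>n. ennreal (exp (real n + 2)) * indicator (E (n + 1)) z)"
        by (intro sum_le_suminf) auto
      finally show ?thesis by (simp add: w_def add_increasing)
    qed
    have "(\<integral>\<^sup>+z. ennreal (exp (pi * (v z)\<^sup>2) - 1) \<partial>lborel) \<le>
       (\<integral>\<^sup>+z. ennreal (2 * pi) * ennreal ((v z)\<^sup>2)
        + (\<Sum>n. ennreal (exp (real n + 2)) * indicator (E (n + 1)) z) \<partial>lborel)"
      by (intro nn_integral_mono pointwise)
    also have "\<dots> = ennreal (2 * pi) * (\<integral>\<^sup>+z. ennreal ((v z)\<^sup>2) \<partial>lborel) +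
        (\<Sum>n. \<integral>\<^sup>+z. ennreal (exp (real n + 2)) * indicator (E (n + 1)) z \<partial>lborel)"
      by (subst nn_integral_add) (auto simp: nn_integral_cmult nn_integral_suminf)
    also have "\<dots> \<le> ennreal (2 * pi) * ennreal 4 + ennreal (exp 1 * C1)"
    proof (intro add_mono mult_left_mono v2)
      show "(\<Sum>n. \<integral>\<^sup>+z. ennreal (exp (real n + 2)) * indicator (E (n + 1)) z \<partial>lborel) \<le> ennreal (exp 1 * C1)"
      proof (intro suminf_le_const)
        fix N
        have "(\<Sum>n<N. \<integral>\<^sup>+z. ennreal (exp (real n + 2)) * indicator (E (n + 1)) z \<partial>lborel) =
            (\<Sum>n<N. ennreal (exp (real n + 2) * e (n + 1)))"
          using e by (intro sum.cong) (auto simp: nn_integral_cmult ennreal_mult e_def)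
        also have "\<dots> = ennreal (\<Sum>n<N. exp (real n + 2) * e (n + 1))"
          by (intro sum_ennreal) (auto simp: e_def)
        also have "(\<Sum>n<N. exp (real n + 2) * e (n + 1)) = exp 1 * (\<Sum>n<N. exp (real (Suc n)) * e (Suc n))"
          unfolding sum_distrib_left
        proof (intro sum.cong refl)
          fix n
          have "exp (real n + 2) = exp 1 * exp (real (Suc n))" by (simp flip: exp_add)
          then show "exp (real n + 2) * e (n + 1) = exp 1 * (exp (real (Suc n)) * e (Suc n))" by simp
        qed
        also have "(\<Sum>n<N. exp (real (Suc n)) * e (Suc n)) = (\<Sum>n = 1..N. exp (real n) * e n)"
          by (rule sum.reindex_bij_witness[of _ "\<lambda>n. n - 1" Suc]) auto
        also have "ennreal (exp 1 * (\<Sum>n = 1..N. exp (real n) * e n)) \<le> ennreal (exp 1 * C1)"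
          by (intro ennreal_leI mult_left_mono sum) auto
        finally show "(\<Sum>n<N. \<integral>\<^sup>+z. ennreal (exp (real n + 2)) * indicator (E (n + 1)) z \<partial>lborel) \<le> ennreal (exp 1 * C1)" .
      qed auto
    qed auto
    also have "ennreal (2 * pi) * ennreal 4 = ennreal (8 * pi)"
      by (subst ennreal_mult[symmetric]) auto
    also have "ennreal (8 * pi) + ennreal (exp 1 * C1) = ennreal (8 * pi + exp 1 * C1)"
      by (rule ennreal_plus[symmetric]) (auto simp: C1_def)
    finally show "(\<integral>\<^sup>+z. ennreal (exp (pi * (v z)\<^sup>2) - 1) \<partial>lborel) \<le> ennreal (8 * pi + exp 1 * C1)" .
  qed
qed

section \<open>Radial representation of boundary values\<close>

text \<open>
  Integrating the derivative of \<open>\<phi> cos r\<close> along a ray, with \<open>(cos r)\<^sup>2 + (sin r)\<^sup>2 = 1\<close>, bounds the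
  boundary value by the full \<open>H\<^sup>1\<close> energy density with the exact kernel \<open>1 / (\<pi> r)\<close>, \<open>r < \<pi> / 2\<close>.
\<close>

lemma abs_le_nn_integral_ray:
  fixes \<phi> :: "real \<times> real \<Rightarrow> real"
  assumes D: "\<And>p. GDERIV \<phi> p :> D p" and cont: "continuous_on UNIV D"
    and ac: "a\<^sup>2 + c\<^sup>2 = 1"
  shows "ennreal \<bar>\<phi> (z, 0)\<bar> \<le>
    (\<integral>\<^sup>+r. ennreal (sqrt ((norm (D (z + r * a, r * c)))\<^sup>2 + (\<phi> (z + r * a, r * c))\<^sup>2)) * indicator {0..pi / 2} r \<partial>lborel)"
proof -
  define F where "F p = sqrt ((norm (D p))\<^sup>2 + (\<phi> p)\<^sup>2)" for p
  define \<gamma> where "\<gamma> r = (z + r * a, r * c)" for r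
  define G where "G r = \<phi> (\<gamma> r) * cos r" for r
  define G' where "G' r = inner (a, c) (D (\<gamma> r)) * cos r - \<phi> (\<gamma> r) * sin r" for r
  have d\<phi>: "(\<phi> has_derivative (\<lambda>h. inner h (D p))) (at p)" for p
    using D[of p] by (simp add: gderiv_def)
  have \<phi>_cont: "continuous_on UNIV \<phi>"
    by (intro continuous_at_imp_continuous_on ballI has_derivative_continuous[OF d\<phi>])
  have \<gamma>_cont: "continuous_on A \<gamma>" for A
    unfolding \<gamma>_def by (intro continuous_intros)
  have "(\<gamma> has_derivative (\<lambda>h. (h * a, h * c))) (at r)" for r
    unfolding \<gamma>_def by (auto intro!: derivative_eq_intros)
  from has_derivative_compose[OF this d\<phi>]
  have "((\<lambda>r. \<phi> (\<gamma> r)) has_derivative (\<lambda>h. h * inner (a, c) (D (\<gamma> r)))) (at r)" for r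
    by (simp add: inner_prod_def algebra_simps)
  moreover have "(*) u = (\<lambda>h. h * u)" for u :: real by (auto simp: mult.commute)
  ultimately have "((\<lambda>r. \<phi> (\<gamma> r)) has_real_derivative inner (a, c) (D (\<gamma> r))) (at r)" for r
    unfolding has_field_derivative_def by metis
  then have "(G has_real_derivative G' r) (at r)" for r
    unfolding G_def G'_def by (auto intro!: derivative_eq_intros)
  then have "(G has_vector_derivative G' r) (at r within {0..pi / 2})" for r
    by (simp add: has_real_derivative_iff_has_vector_derivative has_vector_derivative_at_within)
  then have int: "(G' has_integral (G (pi / 2) - G 0)) {0..pi / 2}"
    by (intro fundamental_theorem_of_calculus) auto
  have "continuous_on UNIV F"
    unfolding F_def by (intro continuous_intros cont \<phi>_cont)
  then have "continuous_on {0..pi / 2} (\<lambda>r. F (\<gamma> r))"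
    by (rule continuous_on_compose2[OF _ \<gamma>_cont]) auto
  then have F_int: "(\<lambda>r. F (\<gamma> r)) integrable_on {0..pi / 2}"
    by (rule integrable_continuous_interval)
  have le: "norm (G' r) \<le> F (\<gamma> r)" for r
  proof -
    let ?u = "inner (a, c) (D (\<gamma> r))"
    have "\<bar>?u\<bar> \<le> norm (a, c) * norm (D (\<gamma> r))" by (rule Cauchy_Schwarz_ineq2)
    also have "norm (a, c) = 1" using ac by (simp add: norm_prod_def)
    finally have u: "?u\<^sup>2 \<le> (norm (D (\<gamma> r)))\<^sup>2" by (simp add: abs_le_square_iff[symmetric])
    \<comment> \<open>The added square completes the rotation of the vector (\<open>?u\<close>,
      \<open>\<phi> (\<gamma> r)\<close>) by the angle r, which preserves its length.\<close>
    have "(G' r)\<^sup>2 \<le> (G' r)\<^sup>2 + (?u * sin r + \<phi> (\<gamma> r) * cos r)\<^sup>2" by simp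
    also have "\<dots> = (?u\<^sup>2 + (\<phi> (\<gamma> r))\<^sup>2) * ((sin r)\<^sup>2 + (cos r)\<^sup>2)"
      unfolding G'_def by algebra
    also have "\<dots> \<le> (norm (D (\<gamma> r)))\<^sup>2 + (\<phi> (\<gamma> r))\<^sup>2" using u by simp
    finally show ?thesis
      unfolding F_def by (metis real_norm_def real_sqrt_abs real_sqrt_le_mono)
  qed
  \<comment> \<open>Since \<open>cos (pi / 2) = 0\<close>, the far end of the ray contributes no
    value of \<phi>.\<close>
  have "\<bar>\<phi> (z, 0)\<bar> = norm (integral {0..pi / 2} G')"
    using integral_unique[OF int] by (simp add: G_def \<gamma>_def)
  also have "\<dots> \<le> integral {0..pi / 2} (\<lambda>r. F (\<gamma> r))"
    using int le by (intro integral_norm_bound_integral F_int) auto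
  finally have "ennreal \<bar>\<phi> (z, 0)\<bar> \<le> ennreal (integral {0..pi / 2} (\<lambda>r. F (\<gamma> r)))"
    by (rule ennreal_leI)
  also have "\<dots> = (\<integral>\<^sup>+r. ennreal (F (\<gamma> r)) * indicator {0..pi / 2} r \<partial>lborel)"
    using F_int by (intro nn_integral_has_integral_lebesgue'[symmetric]) (auto simp: F_def)
  finally show ?thesis by (simp add: F_def \<gamma>_def)
qed

text \<open>The ray inequality is integrated over all directions, of total mass \<pi>. In polar
  coordinates dr times the angular measure is the area divided by the distance to (z, 0), which is
  the kernel.\<close>

lemma abs_le_potential:
  fixes \<phi> :: "real \<times> real \<Rightarrow> real"
  assumes D: "\<And>p. GDERIV \<phi> p :> D p" and cont: "continuous_on UNIV D"
  shows "ennreal (pi * \<bar>\<phi> (z, 0)\<bar>) \<le> potential 0 (pi / 2) (\<lambda>p. ennreal (sqrt ((norm (D p))\<^sup>2 + (\<phi> p)\<^sup>2))) z"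
proof -
  define F where "F p = ennreal (sqrt ((norm (D p))\<^sup>2 + (\<phi> p)\<^sup>2))" for p
  have \<phi>_cont: "continuous_on UNIV \<phi>"
    using D by (auto simp: gderiv_def intro!: continuous_at_imp_continuous_on has_derivative_continuous)
  have "continuous_on UNIV (\<lambda>p. sqrt ((norm (D p))\<^sup>2 + (\<phi> p)\<^sup>2))"
    by (intro continuous_intros cont \<phi>_cont)
  then have F_measurable [measurable]: "F \<in> borel_measurable borel"
    unfolding F_def by (intro measurable_compose[OF borel_measurable_continuous_onI measurable_ennreal])
  have [measurable]: "(\<lambda>p. indicator {0..<pi / 2} (dist p (z, 0 :: real)) * ennreal (1 / dist p (z, 0))) \<in> borel_measurable borel"
    by measurable
  let ?\<gamma> = "\<lambda>s r. (z + r * (s / sqrt (1 + s\<^sup>2)), r / sqrt (1 + s\<^sup>2))"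
  have ray: "ennreal \<bar>\<phi> (z, 0)\<bar> \<le> (\<integral>\<^sup>+r. ennreal r * indicator {0<..} r *
        (F (?\<gamma> s r) * (indicator {0..<pi / 2} (dist (?\<gamma> s r) (z, 0)) * ennreal (1 / dist (?\<gamma> s r) (z, 0)))) \<partial>lborel)"
    for s
  proof -
    have pos: "1 + s\<^sup>2 > 0" by (simp add: add_pos_nonneg)
    have "(s / sqrt (1 + s\<^sup>2))\<^sup>2 + (1 / sqrt (1 + s\<^sup>2))\<^sup>2 = (s\<^sup>2 + 1) / (1 + s\<^sup>2)"
      using pos by (simp add: power_divide add_divide_distrib)
    also have "\<dots> = 1" using pos by (simp add: add.commute)
    finally have "ennreal \<bar>\<phi> (z, 0)\<bar> \<le> (\<integral>\<^sup>+r. F (?\<gamma> s r) * indicator {0..pi / 2} r \<partial>lborel)"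
      using abs_le_nn_integral_ray[OF D cont, of "s / sqrt (1 + s\<^sup>2)" "1 / sqrt (1 + s\<^sup>2)" z] by (simp add: F_def)
    also have "\<dots> = (\<integral>\<^sup>+r. ennreal r * indicator {0<..} r *
        (F (?\<gamma> s r) * (indicator {0..<pi / 2} (dist (?\<gamma> s r) (z, 0)) * ennreal (1 / dist (?\<gamma> s r) (z, 0)))) \<partial>lborel)"
    \<comment> \<open>The integrands can differ only at r = 0, where the Jacobian side vanishes, and
      at r = \<pi>/2, where a closed interval meets a half-open one.\<close>
    proof (intro nn_integral_cong_AE AE_I[where N = "{0, pi / 2}"])
      have "F (?\<gamma> s r) * indicator {0..pi / 2} r = ennreal r * indicator {0<..} r *
        (F (?\<gamma> s r) * (indicator {0..<pi / 2} (dist (?\<gamma> s r) (z, 0)) * ennreal (1 / dist (?\<gamma> s r) (z, 0))))"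
        if ne: "r \<notin> {0, pi / 2}" for r
      proof (cases "0 < r")
        case True
        define q where "q = ?\<gamma> s r"
        have d: "dist q (z, 0) = r" unfolding q_def using True by (intro dist_polar) simp
        have "ennreal r * (F q * ennreal (1 / r)) = F q * (ennreal r * ennreal (1 / r))"
          by (simp only: mult_ac)
        also have "ennreal r * ennreal (1 / r) = 1" using True by (simp flip: ennreal_mult)
        finally show ?thesis
          using ne True unfolding q_def[symmetric] d by (auto split: split_indicator)
      qed (use ne in \<open>auto split: split_indicator\<close>)
      then show "{r \<in> space lborel. F (?\<gamma> s r) * indicator {0..pi / 2} r \<noteq> ennreal r * indicator {0<..} r *
        (F (?\<gamma> s r) * (indicator {0..<pi / 2} (dist (?\<gamma> s r) (z, 0)) * ennreal (1 / dist (?\<gamma> s r) (z, 0))))} \<subseteq> {0, pi / 2}"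
        by blast
    qed (auto simp: emeasure_lborel_countable)
    finally show ?thesis .
  qed
  have "ennreal (pi * \<bar>\<phi> (z, 0)\<bar>) = (\<integral>\<^sup>+s. ennreal (1 / (1 + s\<^sup>2)) * ennreal \<bar>\<phi> (z, 0)\<bar> \<partial>lborel)"
    by (subst nn_integral_multc) (auto simp: nn_integral_inverse_1_plus_square ennreal_mult)
  also have "\<dots> \<le> (\<integral>\<^sup>+s. ennreal (1 / (1 + s\<^sup>2)) * (\<integral>\<^sup>+r. ennreal r * indicator {0<..} r *
        (F (?\<gamma> s r) * (indicator {0..<pi / 2} (dist (?\<gamma> s r) (z, 0)) * ennreal (1 / dist (?\<gamma> s r) (z, 0)))) \<partial>lborel) \<partial>lborel)"
    by (intro nn_integral_mono mult_left_mono ray) auto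
  also have "\<dots> = (\<integral>\<^sup>+p. F p * (indicator {0..<pi / 2} (dist p (z, 0)) * ennreal (1 / dist p (z, 0))) * indicator upper_half_plane p \<partial>lborel)"
    by (rule nn_integral_polar[symmetric]) measurable
  also have "\<dots> = potential 0 (pi / 2) F z"
    unfolding potential_def annulus_kernel_def by (simp add: mult_ac)
  finally show ?thesis by (simp add: F_def[abs_def])
qed

section \<open>Smooth functions and cutoffs\<close>

lemma GDERIV_unique:
  assumes "GDERIV f p :> D" "GDERIV f p :> D'"
  shows "D = D'"
proof -
  have "(\<lambda>h. inner h D) = (\<lambda>h. inner h D')"
    using assms has_derivative_unique unfolding gderiv_def by blast
  then have "inner (D - D') D = inner (D - D') D'" by metis
  then have "inner (D - D') (D - D') = 0" by (simp add: inner_diff_right)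
  then show ?thesis by simp
qed

lemma GDERIV_isCont: "GDERIV f p :> D \<Longrightarrow> isCont f p"
  unfolding gderiv_def by (rule has_derivative_continuous)

lemma GDERIV_continuous_on: "(\<And>p. GDERIV f p :> D p) \<Longrightarrow> continuous_on A f"
  by (intro continuous_at_imp_continuous_on ballI GDERIV_isCont)

lemma Ck_SucD: "Ck (Suc k) f \<Longrightarrow> Ck k f"
proof (induction k arbitrary: f)
  case 0
  then obtain D where "\<forall>p. GDERIV f p :> D p" unfolding Ck.simps(2) by blast
  then show ?case unfolding Ck.simps(1) using GDERIV_continuous_on[of f D UNIV] by blast
next
  case (Suc k)
  then obtain D where "\<forall>p. GDERIV f p :> D p" "Ck (Suc k) (\<lambda>p. fst (D p))" "Ck (Suc k) (\<lambda>p. snd (D p))"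
    unfolding Ck.simps(2)[of "Suc k"] by blast
  moreover from this have "Ck k (\<lambda>p. fst (D p))" "Ck k (\<lambda>p. snd (D p))"
    using Suc.IH by blast+
  ultimately show ?case unfolding Ck.simps(2)[of k f] by blast
qed

lemma Ck_const: "Ck k (\<lambda>_. c)"
proof (induction k arbitrary: c)
  case (Suc k)
  have "\<forall>p :: real \<times> real. GDERIV (\<lambda>_. c) p :> 0" by (simp add: GDERIV_const)
  then show ?case using Suc by (auto intro!: exI[of _ "\<lambda>_. 0"])
qed simp

lemma Ck_add: "Ck k f \<Longrightarrow> Ck k g \<Longrightarrow> Ck k (\<lambda>p. f p + g p)"
proof (induction k arbitrary: f g)
  case (Suc k)
  then obtain D E where D: "\<forall>p. GDERIV f p :> D p" "Ck k (\<lambda>p. fst (D p))" "Ck k (\<lambda>p. snd (D p))"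
    and E: "\<forall>p. GDERIV g p :> E p" "Ck k (\<lambda>p. fst (E p))" "Ck k (\<lambda>p. snd (E p))"
    by auto
  have "\<forall>p. GDERIV (\<lambda>p. f p + g p) p :> D p + E p"
    using D E by (auto intro: GDERIV_add)
  moreover have "Ck k (\<lambda>p. fst (D p + E p))" "Ck k (\<lambda>p. snd (D p + E p))"
    using Suc.IH[OF D(2) E(2)] Suc.IH[OF D(3) E(3)] by simp_all
  ultimately show ?case
    by (simp only: Ck.simps) (intro exI conjI)
qed (auto intro: continuous_intros)

lemma Ck_mult: "Ck k f \<Longrightarrow> Ck k g \<Longrightarrow> Ck k (\<lambda>p. f p * g p)"
proof (induction k arbitrary: f g)
  case (Suc k)
  then have fg: "Ck k f" "Ck k g" by (auto intro: Ck_SucD simp del: Ck.simps)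
  from Suc.prems obtain D E where D: "\<forall>p. GDERIV f p :> D p" "Ck k (\<lambda>p. fst (D p))" "Ck k (\<lambda>p. snd (D p))"
    and E: "\<forall>p. GDERIV g p :> E p" "Ck k (\<lambda>p. fst (E p))" "Ck k (\<lambda>p. snd (E p))"
    by auto
  have "\<forall>p. GDERIV (\<lambda>p. f p * g p) p :> f p *\<^sub>R E p + g p *\<^sub>R D p"
    using D E by (auto intro: GDERIV_mult)
  moreover have "Ck k (\<lambda>p. fst (f p *\<^sub>R E p + g p *\<^sub>R D p))" "Ck k (\<lambda>p. snd (f p *\<^sub>R E p + g p *\<^sub>R D p))"
    using Ck_add[OF Suc.IH[OF fg(1) E(2)] Suc.IH[OF fg(2) D(2)]]
      Ck_add[OF Suc.IH[OF fg(1) E(3)] Suc.IH[OF fg(2) D(3)]] by simp_all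
  ultimately show ?case
    by (simp only: Ck.simps) (intro exI conjI)
qed (auto intro: continuous_intros)

text \<open>\<open>Ck\<close> asserts for each order the existence of some gradient; uniqueness
  identifies all of them with the given one.\<close>

lemma smooth_gradient:
  assumes "\<forall>k. Ck k f" "\<forall>p. GDERIV f p :> D p"
  shows "\<forall>k. Ck k (\<lambda>p. fst (D p))" "\<forall>k. Ck k (\<lambda>p. snd (D p))"
proof -
  have "Ck k (\<lambda>p. fst (D p)) \<and> Ck k (\<lambda>p. snd (D p))" for k
  proof -
    have "Ck (Suc k) f" using assms by blast
    then obtain D' where D': "\<forall>p. GDERIV f p :> D' p" "Ck k (\<lambda>p. fst (D' p))" "Ck k (\<lambda>p. snd (D' p))"
      by auto
    have "D' p = D p" for p using D'(1) assms(2) by (metis GDERIV_unique)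
    then have "D' = D" by (rule ext)
    with D' show ?thesis by simp
  qed
  then show "\<forall>k. Ck k (\<lambda>p. fst (D p))" "\<forall>k. Ck k (\<lambda>p. snd (D p))" by auto
qed

lemma smooth_obtains_gradient:
  assumes "\<forall>k. Ck k f"
  obtains D where "\<forall>p. GDERIV f p :> D p" "continuous_on UNIV D"
    "\<forall>k. Ck k (\<lambda>p. fst (D p))" "\<forall>k. Ck k (\<lambda>p. snd (D p))"
proof -
  have "Ck (Suc 0) f" using assms by blast
  then obtain D where D: "\<forall>p. GDERIV f p :> D p" by auto
  have s: "\<forall>k. Ck k (\<lambda>p. fst (D p))" "\<forall>k. Ck k (\<lambda>p. snd (D p))"
    using smooth_gradient[OF assms D] by auto
  have "continuous_on UNIV (\<lambda>p. (fst (D p), snd (D p)))"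
    using s[THEN spec[of _ 0]] by (intro continuous_on_Pair) auto
  then show ?thesis using that D s by simp
qed

text \<open>The smallest natural family that contains the flat function exp(-1/s), its case n = 0,
  and is closed under differentiation up to linear combinations. Smoothness then follows by
  induction for all n at once. For n = 0 the values lie in [0, 1] and tend to 1 at infinity, which
  suffices for a cutoff.\<close>

definition exp_inverse_power :: "nat \<Rightarrow> real \<Rightarrow> real" where
  "exp_inverse_power n s = (if s > 0 then (1 / s) ^ n * exp (- 1 / s) else 0)"

lemma DERIV_exp_inverse_power:
  "(exp_inverse_power n has_real_derivative
     exp_inverse_power (n + 2) s - real n * exp_inverse_power (n + 1) s) (at s)"
proof (cases "s = 0")
  case True
  \<comment> \<open>With \<open>x = 1 / h\<close> the difference quotient at 0 from the right is
    \<open>x ^ (n + 1) / exp x\<close>.\<close>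
  have "((\<lambda>x::real. x ^ (n + 1) / exp x) \<longlongrightarrow> 0) at_top" by (rule tendsto_power_div_exp_0)
  then have "((\<lambda>h::real. (inverse h) ^ (n + 1) / exp (inverse h)) \<longlongrightarrow> 0) (at_right 0)"
    by (rule filterlim_compose) (rule filterlim_inverse_at_top_right)
  then have "((\<lambda>h. exp_inverse_power n h / h) \<longlongrightarrow> 0) (at_right 0)"
  proof (rule Lim_transform_eventually)
    show "\<forall>\<^sub>F h in at_right 0. inverse h ^ (n + 1) / exp (inverse h) = exp_inverse_power n h / h"
      by (auto simp: eventually_at_filter exp_inverse_power_def exp_minus field_simps)
  qed
  moreover have "((\<lambda>h. exp_inverse_power n h / h) \<longlongrightarrow> 0) (at_left 0)"
    by (rule tendsto_eventually) (auto simp: eventually_at_filter exp_inverse_power_def)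
  ultimately have "((\<lambda>h. exp_inverse_power n h / h) \<longlongrightarrow> 0) (at 0)"
    by (simp add: filterlim_split_at)
  then show ?thesis using True by (simp add: DERIV_def exp_inverse_power_def)
next
  case False
  show ?thesis
  proof (cases "s > 0")
    case True
    have du: "((\<lambda>s. 1 / s) has_real_derivative - ((1 / s)\<^sup>2)) (at s)"
      using True by (auto intro!: derivative_eq_intros simp: power2_eq_square)
    have "((\<lambda>s. (1 / s) ^ n * exp (- (1 / s))) has_real_derivative
        of_nat n * (- (1 / s)\<^sup>2 * (1 / s) ^ (n - Suc 0)) * exp (- (1 / s))
          + exp (- (1 / s)) * - (- (1 / s)\<^sup>2) * (1 / s) ^ n) (at s)"
      by (intro DERIV_mult DERIV_power DERIV_fun_exp DERIV_minus du)
    then have "((\<lambda>s. (1 / s) ^ n * exp (- (1 / s))) has_real_derivative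
        exp_inverse_power (n + 2) s - real n * exp_inverse_power (n + 1) s) (at s)"
    proof (rule DERIV_cong)
      define u where "u = 1 / s"
      have key: "of_nat n * (- u\<^sup>2 * u ^ (n - Suc 0)) = - (real n * u ^ (n + 1))"
        by (cases n) (simp_all add: power2_eq_square)
      have e: "exp_inverse_power (n + 2) s = u ^ n * u\<^sup>2 * exp (- u)"
          "exp_inverse_power (n + 1) s = u ^ (n + 1) * exp (- u)"
        using True by (simp_all only: exp_inverse_power_def u_def if_True minus_divide_left power_add)
      show "of_nat n * (- (1 / s)\<^sup>2 * (1 / s) ^ (n - Suc 0)) * exp (- (1 / s))
          + exp (- (1 / s)) * - (- (1 / s)\<^sup>2) * (1 / s) ^ n =
        exp_inverse_power (n + 2) s - real n * exp_inverse_power (n + 1) s"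
        unfolding u_def[symmetric] key e by (simp only: mult_ac minus_minus mult_minus_left) simp
    qed
    then have "((\<lambda>s. (1 / s) ^ n * exp (- 1 / s)) has_real_derivative
        exp_inverse_power (n + 2) s - real n * exp_inverse_power (n + 1) s) (at s)"
      by (simp only: minus_divide_left)
    then show ?thesis
    proof (rule has_field_derivative_transform_within_open)
      show "open {0::real<..}" "s \<in> {0<..}" using True by auto
    qed (auto simp: exp_inverse_power_def)
  next
    case neg: False
    have "((\<lambda>s. 0) has_real_derivative 0) (at s)" by simp
    then have "(exp_inverse_power n has_real_derivative 0) (at s)"
    proof (rule has_field_derivative_transform_within_open)
      show "open {..<0::real}" "s \<in> {..<0}" using neg False by auto
    qed (auto simp: exp_inverse_power_def)
    then show ?thesis using neg by (simp add: exp_inverse_power_def)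
  qed
qed

lemma Ck_exp_inverse_power: "Ck k (\<lambda>p. exp_inverse_power n (a * snd p + b))"
proof (induction k arbitrary: n)
  case 0
  have "continuous_on UNIV (exp_inverse_power n)"
    using DERIV_exp_inverse_power by (meson DERIV_isCont continuous_at_imp_continuous_on)
  then show ?case
    by (auto intro!: continuous_intros continuous_on_compose2[of UNIV "exp_inverse_power n"])
next
  case (Suc k)
  let ?h = "\<lambda>n p. exp_inverse_power n (a * snd p + b)"
  define D where "D p = (0 :: real, a * (?h (n + 2) p + (- real n) * ?h (n + 1) p))" for p :: "real \<times> real"
  have "GDERIV (?h n) p :> D p" for p
  proof -
    have lin: "((\<lambda>p. a * snd p + b) has_derivative (\<lambda>h. a * snd h)) (at p)"
      by (auto intro!: derivative_eq_intros)
    have "(exp_inverse_power n has_derivative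
       (*) (?h (n + 2) p - real n * ?h (n + 1) p)) (at (a * snd p + b))"
      using DERIV_exp_inverse_power[of n "a * snd p + b"] by (simp add: has_field_derivative_def)
    from has_derivative_compose[OF lin this] show ?thesis
      by (simp add: gderiv_def D_def inner_prod_def algebra_simps)
  qed
  moreover have "Ck k (\<lambda>p. fst (D p))" by (simp add: D_def Ck_const)
  moreover have "Ck k (\<lambda>p. snd (D p))"
    unfolding D_def snd_conv by (intro Ck_mult Ck_add Ck_const Suc)
  ultimately show ?case by auto
qed

section \<open>Integrals of compactly supported functions\<close>

lemma continuous_compact_support_integrable:
  fixes f :: "'a::euclidean_space \<Rightarrow> 'b::euclidean_space"
  assumes cont: "continuous_on UNIV f" and K: "compact K" and zero: "\<And>x. x \<notin> K \<Longrightarrow> f x = 0"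
  shows "integrable lborel f"
proof -
  have "integrable lborel (\<lambda>x. indicator K x *\<^sub>R f x)"
    using K continuous_on_subset[OF cont] by (intro borel_integrable_compact) auto
  moreover have "(\<lambda>x. indicator K x *\<^sub>R f x) = f"
    using zero by (auto simp: fun_eq_iff split: split_indicator)
  ultimately show ?thesis by simp
qed

lemma borel_measurable_lebesgue_on:
  "f \<in> borel_measurable borel \<Longrightarrow> f \<in> borel_measurable (lebesgue_on S)"
  by (intro measurable_restrict_space1 measurable_completion) simp

lemma integrable_lebesgue_on:
  fixes f :: "real \<times> real \<Rightarrow> 'b::{banach, second_countable_topology}"
  assumes f: "integrable lborel f"
  shows "integrable (lebesgue_on upper_half_plane) f"
proof -
  have "integrable lebesgue f"
    using f integrable_completion[OF borel_measurable_integrable[OF f]] by simp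
  then show ?thesis
    by (subst integrable_restrict_space) (auto intro!: integrable_mult_indicator sets_completionI_sets)
qed

lemma integral_lebesgue_on:
  fixes f :: "real \<times> real \<Rightarrow> 'b::{banach, second_countable_topology}"
  assumes "f \<in> borel_measurable borel" and "\<And>p. p \<notin> upper_half_plane \<Longrightarrow> f p = 0"
  shows "integral\<^sup>L (lebesgue_on upper_half_plane) f = integral\<^sup>L lborel f"
proof -
  have eq: "(\<lambda>p. indicator upper_half_plane p *\<^sub>R f p) = f"
    using assms by (auto simp: fun_eq_iff split: split_indicator)
  have "integral\<^sup>L (lebesgue_on upper_half_plane) f = integral\<^sup>L lebesgue f"
    by (subst integral_restrict_space) (auto simp: eq)
  also have "\<dots> = integral\<^sup>L lborel f"
    using assms by (intro integral_completion) simp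
  finally show ?thesis .
qed

text \<open>By Fubini each component is integrated first in its own variable, where the fundamental
  theorem of calculus leaves only endpoints outside \<open>K\<close>. Applied to a product, this
  yields integration by parts.\<close>

lemma integral_gradient_compact_support:
  fixes h :: "real \<times> real \<Rightarrow> real"
  assumes D: "\<And>p. GDERIV h p :> D p" and cont: "continuous_on UNIV D"
    and K: "compact K" and h0: "\<And>p. p \<notin> K \<Longrightarrow> h p = 0" and D0: "\<And>p. p \<notin> K \<Longrightarrow> D p = 0"
  shows "integral\<^sup>L lborel D = 0"
proof -
  obtain B where "\<forall>p\<in>K. norm p \<le> B" using compact_imp_bounded[OF K] by (auto simp: bounded_iff)
  then have B: "norm p \<le> \<bar>B\<bar>" if "p \<in> K" for p using that by force
  define R where "R = \<bar>B\<bar> + 1"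
  have out: "(x, y) \<notin> K" if "\<bar>x\<bar> \<ge> R \<or> \<bar>y\<bar> \<ge> R" for x y
    using B[of "(x, y)"] norm_fst_le[of x y] norm_snd_le[of y x] that
    by (auto simp: R_def)
  have intD: "integrable lborel D"
    by (rule continuous_compact_support_integrable[OF cont K D0])
  have d: "(h has_derivative (\<lambda>v. inner v (D p))) (at p)" for p
    using D by (simp add: gderiv_def)
  have dx: "((\<lambda>x. h (x, y)) has_real_derivative fst (D (x, y))) (at x)" for x y
  proof -
    have "((\<lambda>x. (x, y)) has_derivative (\<lambda>v. (v, 0))) (at x)" by (auto intro!: derivative_eq_intros)
    from has_derivative_compose[OF this d] show ?thesis
      by (simp add: has_field_derivative_def inner_prod_def mult_commute_abs)
  qed
  have dy: "((\<lambda>y. h (x, y)) has_real_derivative snd (D (x, y))) (at y)" for x y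
  proof -
    have "((\<lambda>y. (x, y)) has_derivative (\<lambda>v. (0, v))) (at y)" by (auto intro!: derivative_eq_intros)
    from has_derivative_compose[OF this d] show ?thesis
      by (simp add: has_field_derivative_def inner_prod_def mult_commute_abs)
  qed
  have vanish: "integral\<^sup>L lborel g' = 0"
    if g: "\<And>x. (g has_real_derivative g' x) (at x)" and g': "continuous_on UNIV g'"
      and z: "\<And>x. \<bar>x\<bar> \<ge> R \<Longrightarrow> g x = 0" "\<And>x. \<bar>x\<bar> \<ge> R \<Longrightarrow> g' x = 0" for g g' :: "real \<Rightarrow> real"
  proof -
    have "integral\<^sup>L lborel g' = (\<integral>x. g' x * indicator {- R..R} x \<partial>lborel)"
      using z(2) by (intro Bochner_Integration.integral_cong) (force split: split_indicator)+
    also have "\<dots> = g R - g (- R)"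
      using g g' by (intro integral_FTC_Icc_real) (auto simp: R_def continuous_on_eq_continuous_at)
    also have "\<dots> = 0" using z(1)[of R] z(1)[of "- R"] by (simp add: R_def)
    finally show ?thesis .
  qed
  have c1: "continuous_on UNIV (\<lambda>x. D (x, y))" and c2: "continuous_on UNIV (\<lambda>x. D (y, x))" for y
    by (auto intro!: continuous_intros continuous_on_compose2[OF cont])
  have i1: "integrable (lborel \<Otimes>\<^sub>M lborel) (\<lambda>p. fst (D p))"
    using integrable_bounded_linear[OF bounded_linear_fst intD] by (simp add: lborel_prod)
  have i2: "integrable (lborel \<Otimes>\<^sub>M lborel) (\<lambda>p. snd (D p))"
    using integrable_bounded_linear[OF bounded_linear_snd intD] by (simp add: lborel_prod)
  have "fst (integral\<^sup>L lborel D) = (\<integral>p. fst (D p) \<partial>(lborel \<Otimes>\<^sub>M lborel))"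
    using integral_bounded_linear[OF bounded_linear_fst intD] by (simp add: lborel_prod)
  also have "\<dots> = (\<integral>y. (\<integral>x. fst (D (x, y)) \<partial>lborel) \<partial>lborel)"
    using lborel_pair.integral_snd[of "\<lambda>x y. fst (D (x, y))"] i1 by (simp add: case_prod_beta')
  also have "\<dots> = 0"
  proof -
    have "(\<integral>x. fst (D (x, y)) \<partial>lborel) = 0" for y
      by (rule vanish[OF dx]) (auto intro!: continuous_on_fst c1 simp: out h0 D0)
    then show ?thesis by simp
  qed
  finally have f: "fst (integral\<^sup>L lborel D) = 0" .
  have "snd (integral\<^sup>L lborel D) = (\<integral>p. snd (D p) \<partial>(lborel \<Otimes>\<^sub>M lborel))"
    using integral_bounded_linear[OF bounded_linear_snd intD] by (simp add: lborel_prod)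
  also have "\<dots> = (\<integral>x. (\<integral>y. snd (D (x, y)) \<partial>lborel) \<partial>lborel)"
    using lborel_pair.integral_fst'[OF i2] by simp
  also have "\<dots> = 0"
  proof -
    have "(\<integral>y. snd (D (x, y)) \<partial>lborel) = 0" for x
      by (rule vanish[OF dy]) (auto intro!: continuous_on_snd c2 simp: out h0 D0)
    then show ?thesis by simp
  qed
  finally have "snd (integral\<^sup>L lborel D) = 0" .
  with f show ?thesis by (simp add: prod_eq_iff)
qed

section \<open>Weak gradients and energy\<close>

lemma gradient_zero_outside_support:
  assumes D: "\<And>p. GDERIV \<phi> p :> D p" and p: "p \<notin> closure {p. \<phi> p \<noteq> 0}"
  shows "D p = 0"
proof -
  have "((\<lambda>_. 0) has_derivative (\<lambda>h. inner h 0)) (at p)" by simp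
  then have "(\<phi> has_derivative (\<lambda>h. inner h 0)) (at p)"
  proof (rule has_derivative_transform_within_open)
    show "open (- closure {p. \<phi> p \<noteq> 0})" "p \<in> - closure {p. \<phi> p \<noteq> 0}" using p by auto
    fix x assume "x \<in> - closure {p. \<phi> p \<noteq> 0}"
    then show "0 = \<phi> x" using closure_subset[of "{p. \<phi> p \<noteq> 0}"] by auto
  qed
  then have "GDERIV \<phi> p :> 0" by (simp only: gderiv_def)
  with D[of p] show ?thesis by (rule GDERIV_unique)
qed

lemma integrable_continuous_compact_lebesgue_on:
  fixes f :: "real \<times> real \<Rightarrow> 'b::euclidean_space"
  assumes "continuous_on UNIV f" "compact K" "\<And>p. p \<notin> K \<Longrightarrow> f p = 0"
  shows "integrable (lebesgue_on upper_half_plane) f"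
  using continuous_compact_support_integrable[OF assms] by (rule integrable_lebesgue_on)

lemma L2_on_continuous_compact:
  fixes f :: "real \<times> real \<Rightarrow> 'b::euclidean_space"
  assumes "continuous_on UNIV f" "compact K" "\<And>p. p \<notin> K \<Longrightarrow> f p = 0"
  shows "L2_on upper_half_plane f"
  unfolding L2_on_def
proof
  show "f \<in> borel_measurable (lebesgue_on upper_half_plane)"
    using assms by (intro borel_measurable_lebesgue_on borel_measurable_continuous_onI)
  show "integrable (lebesgue_on upper_half_plane) (\<lambda>x. (norm (f x))\<^sup>2)"
    using assms by (intro integrable_continuous_compact_lebesgue_on[of _ K] continuous_intros) auto
qed

text \<open>Young's inequality with a parameter: for small s the second summand is hardly enlarged,
  and the large factor falls on the first, which later tends to 0.\<close>

lemma norm_add_square_le: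
  fixes a b :: "'a::real_normed_vector"
  assumes "s > 0"
  shows "(norm (a + b))\<^sup>2 \<le> (1 + 1 / s) * (norm a)\<^sup>2 + (1 + s) * (norm b)\<^sup>2"
proof -
  have "(norm (a + b))\<^sup>2 \<le> (norm a + norm b)\<^sup>2"
    by (intro power_mono norm_triangle_ineq) auto
  also have "\<dots> = (1 + 1 / s) * (norm a)\<^sup>2 + (1 + s) * (norm b)\<^sup>2 - (norm a - s * norm b)\<^sup>2 / s"
    using assms by (simp add: power2_eq_square field_simps)
  also have "\<dots> \<le> (1 + 1 / s) * (norm a)\<^sup>2 + (1 + s) * (norm b)\<^sup>2"
    using assms by simp
  finally show ?thesis .
qed

section \<open>Sums and products of square-integrable functions\<close>

lemma L2_on_minus: "L2_on S f \<Longrightarrow> L2_on S (\<lambda>x. - f x)"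
  by (auto simp: L2_on_def)

lemma L2_on_add:
  assumes f: "L2_on S f" and g: "L2_on S g"
  shows "L2_on S (\<lambda>x. f x + g x)"
  unfolding L2_on_def
proof
  have [measurable]: "f \<in> borel_measurable (lebesgue_on S)" "g \<in> borel_measurable (lebesgue_on S)"
    using assms by (auto simp: L2_on_def)
  show "(\<lambda>x. f x + g x) \<in> borel_measurable (lebesgue_on S)" by measurable
  show "integrable (lebesgue_on S) (\<lambda>x. (norm (f x + g x))\<^sup>2)"
  proof (rule Bochner_Integration.integrable_bound)
    show "integrable (lebesgue_on S) (\<lambda>x. (1 + 1 / 1) * (norm (f x))\<^sup>2 + (1 + 1) * (norm (g x))\<^sup>2)"
      using assms by (auto simp: L2_on_def)
    show "AE x in lebesgue_on S. norm ((norm (f x + g x))\<^sup>2) \<le> norm ((1 + 1 / 1) * (norm (f x))\<^sup>2 + (1 + 1) * (norm (g x))\<^sup>2)"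
      using norm_add_square_le[of 1 "f _" "g _"] by (intro AE_I2) (auto intro: order_trans)
  qed measurable
qed

lemma L2_on_scaleR_integrable:
  fixes f :: "'a::euclidean_space \<Rightarrow> real" and g :: "'a \<Rightarrow> 'b::euclidean_space"
  assumes f: "L2_on S f" and g: "L2_on S g"
  shows "integrable (lebesgue_on S) (\<lambda>x. f x *\<^sub>R g x)"
proof (rule Bochner_Integration.integrable_bound)
  have [measurable]: "f \<in> borel_measurable (lebesgue_on S)" "g \<in> borel_measurable (lebesgue_on S)"
    using assms by (auto simp: L2_on_def)
  show "integrable (lebesgue_on S) (\<lambda>x. (norm (f x))\<^sup>2 + (norm (g x))\<^sup>2)"
    using assms by (auto simp: L2_on_def)
  show "(\<lambda>x. f x *\<^sub>R g x) \<in> borel_measurable (lebesgue_on S)" by measurable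
  have "norm (f x *\<^sub>R g x) \<le> (norm (f x))\<^sup>2 + (norm (g x))\<^sup>2" for x
  proof -
    have "0 \<le> (norm (f x) - norm (g x))\<^sup>2" by simp
    then have "2 * norm (f x *\<^sub>R g x) \<le> (norm (f x))\<^sup>2 + (norm (g x))\<^sup>2"
      by (simp add: power2_eq_square algebra_simps)
    then show ?thesis using norm_ge_zero[of "f x *\<^sub>R g x"] by linarith
  qed
  then show "AE x in lebesgue_on S. norm (f x *\<^sub>R g x) \<le> norm ((norm (f x))\<^sup>2 + (norm (g x))\<^sup>2)"
    by (intro AE_I2) (auto intro: order_trans)
qed

lemma test_function_L2:
  assumes \<phi>: "test_function S \<phi>" and D: "\<forall>p. GDERIV \<phi> p :> D p"
  shows "L2_on upper_half_plane \<phi>" "L2_on upper_half_plane D"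
proof -
  let ?K = "closure {p. \<phi> p \<noteq> 0}"
  have K: "compact ?K" "\<forall>k. Ck k \<phi>" using \<phi> by (auto simp: test_function_def)
  obtain D' where D': "\<forall>p. GDERIV \<phi> p :> D' p" "continuous_on UNIV D'"
    using smooth_obtains_gradient[OF K(2)] by metis
  have "D' p = D p" for p using D' D by (metis GDERIV_unique)
  then have "D' = D" by (rule ext)
  then have cont: "continuous_on UNIV D" using D' by simp
  show "L2_on upper_half_plane \<phi>"
    using D closure_subset[of "{p. \<phi> p \<noteq> 0}"]
    by (intro L2_on_continuous_compact[OF _ K(1)] GDERIV_continuous_on[of \<phi> D]) auto
  show "L2_on upper_half_plane D"
    using D by (intro L2_on_continuous_compact[OF cont K(1)] gradient_zero_outside_support[of \<phi>]) auto
qed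

text \<open>The factor \<open>\<psi>\<close> is supported inside the open half-plane, so the product
  has integrable gradient with integral 0 over the whole plane. No boundary term appears, although
  \<open>\<phi>\<close> need not vanish on the boundary.\<close>

lemma integration_by_parts_half_plane:
  assumes \<phi>: "\<forall>p. GDERIV \<phi> p :> D p" "continuous_on UNIV D"
    and \<psi>: "test_function upper_half_plane \<psi>" "\<forall>p. GDERIV \<psi> p :> E p"
  shows "integral\<^sup>L (lebesgue_on upper_half_plane) (\<lambda>p. \<phi> p *\<^sub>R E p) =
    - integral\<^sup>L (lebesgue_on upper_half_plane) (\<lambda>p. \<psi> p *\<^sub>R D p)"
proof -
  define K where "K = closure {p. \<psi> p \<noteq> 0}"
  have K: "compact K" "K \<subseteq> upper_half_plane" "\<forall>k. Ck k \<psi>"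
    using \<psi> by (auto simp: test_function_def K_def)
  obtain E' where E': "\<forall>p. GDERIV \<psi> p :> E' p" "continuous_on UNIV E'"
    using smooth_obtains_gradient[OF K(3)] by metis
  have "E' p = E p" for p using E' \<psi> by (metis GDERIV_unique)
  then have "E' = E" by (rule ext)
  then have contE: "continuous_on UNIV E" using E' by simp
  have cont: "continuous_on UNIV \<phi>" "continuous_on UNIV \<psi>"
    by (intro GDERIV_continuous_on[of \<phi> D] spec[OF \<phi>(1)], intro GDERIV_continuous_on[of \<psi> E] spec[OF \<psi>(2)])
  have zero: "\<psi> p = 0" "E p = 0" if "p \<notin> K" for p
    using that \<psi>(2) closure_subset[of "{p. \<psi> p \<noteq> 0}"]
    by (auto simp: K_def intro: gradient_zero_outside_support[of \<psi>])
  have c1: "continuous_on UNIV (\<lambda>p. \<phi> p *\<^sub>R E p)" and c2: "continuous_on UNIV (\<lambda>p. \<psi> p *\<^sub>R D p)"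
    by (intro continuous_intros cont contE \<phi>)+
  have i1: "integrable lborel (\<lambda>p. \<phi> p *\<^sub>R E p)"
    by (rule continuous_compact_support_integrable[OF c1 K(1)]) (simp add: zero)
  have i2: "integrable lborel (\<lambda>p. \<psi> p *\<^sub>R D p)"
    by (rule continuous_compact_support_integrable[OF c2 K(1)]) (simp add: zero)
  have "integral\<^sup>L lborel (\<lambda>p. \<phi> p *\<^sub>R E p + \<psi> p *\<^sub>R D p) = 0"
  proof (rule integral_gradient_compact_support[OF _ _ K(1)])
    show "GDERIV (\<lambda>p. \<phi> p * \<psi> p) p :> \<phi> p *\<^sub>R E p + \<psi> p *\<^sub>R D p" for p
      by (intro GDERIV_mult spec[OF \<phi>(1)] spec[OF \<psi>(2)])
    show "continuous_on UNIV (\<lambda>p. \<phi> p *\<^sub>R E p + \<psi> p *\<^sub>R D p)"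
      by (intro continuous_intros cont contE \<phi>)
  qed (simp_all add: zero)
  then have "integral\<^sup>L lborel (\<lambda>p. \<phi> p *\<^sub>R E p) = - integral\<^sup>L lborel (\<lambda>p. \<psi> p *\<^sub>R D p)"
    using i1 i2 by (simp add: eq_neg_iff_add_eq_0)
  moreover have "integral\<^sup>L (lebesgue_on upper_half_plane) (\<lambda>p. \<phi> p *\<^sub>R E p) = integral\<^sup>L lborel (\<lambda>p. \<phi> p *\<^sub>R E p)"
    using zero contra_subsetD[OF K(2)] by (intro integral_lebesgue_on borel_measurable_continuous_onI c1) simp
  moreover have "integral\<^sup>L (lebesgue_on upper_half_plane) (\<lambda>p. \<psi> p *\<^sub>R D p) = integral\<^sup>L lborel (\<lambda>p. \<psi> p *\<^sub>R D p)"
    using zero contra_subsetD[OF K(2)] by (intro integral_lebesgue_on borel_measurable_continuous_onI c2) simp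
  ultimately show ?thesis by simp
qed

lemma test_function_has_weak_gradient:
  assumes \<phi>: "test_function UNIV \<phi>" "\<forall>p. GDERIV \<phi> p :> D p" "continuous_on UNIV D"
  shows "has_weak_gradient \<phi> D"
  unfolding has_weak_gradient_def
  using integration_by_parts_half_plane[OF \<phi>(2,3)] test_function_L2[OF \<phi>(1,2)] by blast

lemma has_weak_gradient_add:
  assumes "L2_on upper_half_plane u" "has_weak_gradient u G" "L2_on upper_half_plane v" "has_weak_gradient v H"
  shows "has_weak_gradient (\<lambda>p. u p + v p) (\<lambda>p. G p + H p)"
  unfolding has_weak_gradient_def
proof (intro conjI allI impI)
  let ?M = "lebesgue_on upper_half_plane"
  have L2: "L2_on upper_half_plane G" "L2_on upper_half_plane H"
    using assms by (auto simp: has_weak_gradient_def)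
  then show "L2_on upper_half_plane (\<lambda>p. G p + H p)" by (rule L2_on_add)
  fix \<psi> E assume \<psi>: "test_function upper_half_plane \<psi>" "\<forall>p. GDERIV \<psi> p :> E p"
  note L2\<psi> = test_function_L2[OF \<psi>]
  have "integral\<^sup>L ?M (\<lambda>p. (u p + v p) *\<^sub>R E p) = integral\<^sup>L ?M (\<lambda>p. u p *\<^sub>R E p) + integral\<^sup>L ?M (\<lambda>p. v p *\<^sub>R E p)"
    unfolding scaleR_add_left
    by (intro Bochner_Integration.integral_add L2_on_scaleR_integrable assms L2\<psi>)
  also have "\<dots> = - (integral\<^sup>L ?M (\<lambda>p. \<psi> p *\<^sub>R G p) + integral\<^sup>L ?M (\<lambda>p. \<psi> p *\<^sub>R H p))"
    using assms \<psi> unfolding has_weak_gradient_def by simp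
  also have "integral\<^sup>L ?M (\<lambda>p. \<psi> p *\<^sub>R G p) + integral\<^sup>L ?M (\<lambda>p. \<psi> p *\<^sub>R H p) =
     integral\<^sup>L ?M (\<lambda>p. \<psi> p *\<^sub>R (G p + H p))"
    unfolding scaleR_add_right
    by (intro Bochner_Integration.integral_add[symmetric] L2_on_scaleR_integrable L2 L2\<psi>)
  finally show "integral\<^sup>L ?M (\<lambda>p. (u p + v p) *\<^sub>R E p) = - integral\<^sup>L ?M (\<lambda>p. \<psi> p *\<^sub>R (G p + H p))" .
qed

lemma has_weak_gradient_minus:
  assumes "has_weak_gradient u G"
  shows "has_weak_gradient (\<lambda>p. - u p) (\<lambda>p. - G p)"
  using assms unfolding has_weak_gradient_def by (auto intro: L2_on_minus)

lemma H1_weak_gradient: "w \<in> H1 \<Longrightarrow> has_weak_gradient w (weak_gradient w)"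
  unfolding H1_def weak_gradient_def using someI_ex[of "has_weak_gradient w"] by auto

text \<open>
  Testing the weak gradient against the smooth gradient itself, cut off near the boundary, avoids
  the uniqueness of weak gradients.
\<close>

lemma energy_le_weak_gradient:
  assumes \<phi>: "test_function UNIV \<phi>" "\<forall>p. GDERIV \<phi> p :> D p" "continuous_on UNIV D"
    and G: "has_weak_gradient \<phi> G"
  shows "integral\<^sup>L (lebesgue_on upper_half_plane) (\<lambda>p. (norm (D p))\<^sup>2) \<le>
    integral\<^sup>L (lebesgue_on upper_half_plane) (\<lambda>p. (norm (G p))\<^sup>2)"
proof -
  let ?M = "lebesgue_on upper_half_plane"
  \<comment> \<open>The affine argument is positive exactly above height \<open>1 / (n + 1)\<close>
    and tends to infinity at every fixed positive height. So the cutoff vanishes near the boundary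
    and converges to 1 pointwise.\<close>
  define \<eta> where "\<eta> n p = exp_inverse_power 0 ((real n + 1)\<^sup>2 * snd p + (- (real n + 1)))" for n :: nat and p :: "real \<times> real"
  have \<eta>: "0 \<le> \<eta> n p" "\<eta> n p \<le> 1" for n p
    by (auto simp: \<eta>_def exp_inverse_power_def)
  have \<eta>0: "1 / (real n + 1) \<le> snd p" if "\<eta> n p \<noteq> 0" for n p
  proof -
    have "0 < (real n + 1)\<^sup>2 * snd p + (- (real n + 1))"
      using that by (auto simp: \<eta>_def exp_inverse_power_def split: if_splits)
    then have "0 < (real n + 1) * ((real n + 1) * snd p - 1)"
      by (simp add: power2_eq_square algebra_simps)
    then have "1 < (real n + 1) * snd p"
      by (simp add: zero_less_mult_iff)
    then show ?thesis by (simp add: field_simps)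
  qed
  have smooth\<eta>: "\<forall>k. Ck k (\<eta> n)" for n
    unfolding \<eta>_def[abs_def] using Ck_exp_inverse_power by blast
  have \<eta>_lim: "(\<lambda>n. \<eta> n p) \<longlonglongrightarrow> 1" if "p \<in> upper_half_plane" for p
  proof -
    have y: "snd p > 0" using that by (auto simp: upper_half_plane_def)
    have at_top: "filterlim (\<lambda>n. (real n + 1)\<^sup>2 * snd p + (- (real n + 1))) at_top sequentially"
      using y by real_asymp
    then have "(\<lambda>n. exp (- inverse ((real n + 1)\<^sup>2 * snd p + (- (real n + 1))))) \<longlonglongrightarrow> exp (- 0)"
      by (intro tendsto_exp tendsto_minus tendsto_inverse_0_at_top at_top)
    moreover have "\<forall>\<^sub>F n in sequentially. exp (- inverse ((real n + 1)\<^sup>2 * snd p + (- (real n + 1)))) = \<eta> n p"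
      using filterlim_at_top_dense[THEN iffD1, OF at_top, rule_format, of 0]
      by eventually_elim (simp add: \<eta>_def exp_inverse_power_def inverse_eq_divide)
    ultimately show ?thesis by (simp add: tendsto_cong[symmetric])
  qed
  define K where "K = closure {p. \<phi> p \<noteq> 0}"
  have K: "compact K" "\<forall>k. Ck k \<phi>" using \<phi> by (auto simp: test_function_def K_def)
  have D0: "D p = 0" if "p \<notin> K" for p
    using gradient_zero_outside_support[of \<phi> D p] \<phi> that by (auto simp: K_def)
  note smoothD = smooth_gradient[OF K(2) \<phi>(2)]
  have test: "test_function upper_half_plane (\<lambda>p. \<eta> n p * f p)"
    if f: "\<forall>k. Ck k f" and f0: "\<And>p. p \<notin> K \<Longrightarrow> f p = 0" for f n
  proof -
    define K' where "K' = K \<inter> {p. 1 / (real n + 1) \<le> snd p}"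
    have cl: "closed {p :: real \<times> real. 1 / (real n + 1) \<le> snd p}"
      by (intro closed_Collect_le continuous_intros)
    have K': "compact K'" unfolding K'_def using K(1) cl by (rule compact_Int_closed)
    have "{p. \<eta> n p * f p \<noteq> 0} \<subseteq> K'"
      using f0 \<eta>0 by (auto simp: K'_def)
    then have sub: "closure {p. \<eta> n p * f p \<noteq> 0} \<subseteq> K'"
      by (intro closure_minimal compact_imp_closed K')
    have "K' \<subseteq> upper_half_plane"
      by (auto simp: K'_def upper_half_plane_def intro: less_le_trans[of 0 "1 / (real n + 1)"])
    moreover have "compact (closure {p. \<eta> n p * f p \<noteq> 0})"
      using bounded_subset[OF compact_imp_bounded[OF K'] sub]
      by (simp only: compact_eq_bounded_closed closed_closure)
    moreover have "\<forall>k. Ck k (\<lambda>p. \<eta> n p * f p)"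
      by (intro allI Ck_mult spec[OF smooth\<eta>] spec[OF f])
    ultimately show ?thesis
      using sub unfolding test_function_def by blast
  qed
  have L2: "L2_on upper_half_plane G" "L2_on upper_half_plane D"
    using G test_function_L2[OF \<phi>(1,2)] by (auto simp: has_weak_gradient_def)
  have intG: "integrable ?M (\<lambda>p. (norm (G p))\<^sup>2)" and intD: "integrable ?M (\<lambda>p. (norm (D p))\<^sup>2)"
    using L2 by (auto simp: L2_on_def)
  have \<eta>_cont: "continuous_on UNIV (\<eta> n)" for n using smooth\<eta>[of n, rule_format, of 0] by simp
  have eq: "integral\<^sup>L ?M (\<lambda>p. \<psi> p *\<^sub>R G p) = integral\<^sup>L ?M (\<lambda>p. \<psi> p *\<^sub>R D p)"
    if \<psi>: "test_function upper_half_plane \<psi>" for \<psi>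
  proof -
    have "\<forall>k. Ck k \<psi>" using \<psi> by (simp add: test_function_def)
    then obtain E where E: "\<forall>p. GDERIV \<psi> p :> E p" by (metis smooth_obtains_gradient)
    have "integral\<^sup>L ?M (\<lambda>p. \<phi> p *\<^sub>R E p) = - integral\<^sup>L ?M (\<lambda>p. \<psi> p *\<^sub>R H p)"
      if "has_weak_gradient \<phi> H" for H
      using that \<psi> E unfolding has_weak_gradient_def by blast
    from this[OF G] this[OF test_function_has_weak_gradient[OF \<phi>]] show ?thesis by simp
  qed
  have le: "integral\<^sup>L ?M (\<lambda>p. \<eta> n p * (norm (D p))\<^sup>2) \<le> integral\<^sup>L ?M (\<lambda>p. (norm (G p))\<^sup>2)" for n
  proof -
    \<comment> \<open>Test functions are scalar, so the cut-off gradient is tested one component at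
      a time. Adding the components gives equality of the integrals of
      \<open>\<eta> n p * inner (D p) (G p)\<close> and of
      \<open>\<eta> n p * (norm (D p))^2\<close>.\<close>
    have t1: "test_function upper_half_plane (\<lambda>p. \<eta> n p * fst (D p))"
      by (rule test[OF smoothD(1)]) (simp add: D0)
    have t2: "test_function upper_half_plane (\<lambda>p. \<eta> n p * snd (D p))"
      by (rule test[OF smoothD(2)]) (simp add: D0)
    have L2t: "L2_on upper_half_plane \<psi>" if \<psi>: "test_function upper_half_plane \<psi>" for \<psi>
    proof -
      have "\<forall>k. Ck k \<psi>" using \<psi> by (simp add: test_function_def)
      then obtain E where "\<forall>p. GDERIV \<psi> p :> E p" by (metis smooth_obtains_gradient)
      then show ?thesis using test_function_L2(1)[OF \<psi>] by blast
    qed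
    have int: "integrable ?M (\<lambda>p. (\<eta> n p * fst (D p)) *\<^sub>R G p)" "integrable ?M (\<lambda>p. (\<eta> n p * fst (D p)) *\<^sub>R D p)"
        "integrable ?M (\<lambda>p. (\<eta> n p * snd (D p)) *\<^sub>R G p)" "integrable ?M (\<lambda>p. (\<eta> n p * snd (D p)) *\<^sub>R D p)"
      by (intro L2_on_scaleR_integrable L2t t1 t2 L2)+
    have e1: "integral\<^sup>L ?M (\<lambda>p. \<eta> n p * fst (D p) * fst (G p)) = integral\<^sup>L ?M (\<lambda>p. \<eta> n p * fst (D p) * fst (D p))"
      using arg_cong[OF eq[OF t1], of fst] int by (simp flip: integral_fst)
    have e2: "integral\<^sup>L ?M (\<lambda>p. \<eta> n p * snd (D p) * snd (G p)) = integral\<^sup>L ?M (\<lambda>p. \<eta> n p * snd (D p) * snd (D p))"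
      using arg_cong[OF eq[OF t2], of snd] int by (simp flip: integral_snd)
    have i: "integrable ?M (\<lambda>p. \<eta> n p * fst (D p) * fst (G p))" "integrable ?M (\<lambda>p. \<eta> n p * fst (D p) * fst (D p))"
       "integrable ?M (\<lambda>p. \<eta> n p * snd (D p) * snd (G p))" "integrable ?M (\<lambda>p. \<eta> n p * snd (D p) * snd (D p))"
      using integrable_bounded_linear[OF bounded_linear_fst int(1)] integrable_bounded_linear[OF bounded_linear_fst int(2)]
        integrable_bounded_linear[OF bounded_linear_snd int(3)] integrable_bounded_linear[OF bounded_linear_snd int(4)]
      by simp_all
    have sq: "\<eta> n p * (norm (D p))\<^sup>2 = \<eta> n p * fst (D p) * fst (D p) + \<eta> n p * snd (D p) * snd (D p)" for p
      by (simp add: power2_norm_eq_inner inner_prod_def algebra_simps)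
    have int\<eta>: "integrable ?M (\<lambda>p. \<eta> n p * (norm (D p))\<^sup>2)"
      unfolding sq using i by simp
    have "integral\<^sup>L ?M (\<lambda>p. \<eta> n p * (norm (D p))\<^sup>2) =
       integral\<^sup>L ?M (\<lambda>p. \<eta> n p * fst (D p) * fst (G p) + \<eta> n p * snd (D p) * snd (G p))"
      unfolding sq using i e1 e2 by simp
    \<comment> \<open>After the inequality
      \<open>2 * inner (D p) (G p) \<le> (norm (D p))^2 + (norm (G p))^2\<close>, half of the
      left-hand integral reappears on the right and is absorbed.\<close>
    also have "\<dots> \<le> integral\<^sup>L ?M (\<lambda>p. (\<eta> n p * (norm (D p))\<^sup>2 + (norm (G p))\<^sup>2) / 2)"
    proof (rule integral_mono)
      show "integrable ?M (\<lambda>p. \<eta> n p * fst (D p) * fst (G p) + \<eta> n p * snd (D p) * snd (G p))"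
        using i by simp
      show "integrable ?M (\<lambda>p. (\<eta> n p * (norm (D p))\<^sup>2 + (norm (G p))\<^sup>2) / 2)"
        using int\<eta> intG by simp
      fix p
      have "0 \<le> (norm (D p - G p))\<^sup>2" by simp
      then have "2 * inner (D p) (G p) \<le> (norm (D p))\<^sup>2 + (norm (G p))\<^sup>2"
        by (simp add: power2_norm_eq_inner inner_diff inner_commute)
      then have "\<eta> n p * (2 * inner (D p) (G p)) \<le> \<eta> n p * ((norm (D p))\<^sup>2 + (norm (G p))\<^sup>2)"
        using \<eta>(1)[of n p] by (rule mult_left_mono)
      also have "\<dots> \<le> \<eta> n p * (norm (D p))\<^sup>2 + (norm (G p))\<^sup>2"
        using \<eta>[of n p] by (simp add: distrib_left mult_left_le_one_le)
      finally show "\<eta> n p * fst (D p) * fst (G p) + \<eta> n p * snd (D p) * snd (G p) \<le> (\<eta> n p * (norm (D p))\<^sup>2 + (norm (G p))\<^sup>2) / 2"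
        by (simp add: inner_prod_def algebra_simps)
    qed
    also have "\<dots> = (integral\<^sup>L ?M (\<lambda>p. \<eta> n p * (norm (D p))\<^sup>2) + integral\<^sup>L ?M (\<lambda>p. (norm (G p))\<^sup>2)) / 2"
      using int\<eta> intG by simp
    finally show ?thesis by simp
  qed
  have "(\<lambda>n. integral\<^sup>L ?M (\<lambda>p. \<eta> n p * (norm (D p))\<^sup>2)) \<longlonglongrightarrow> integral\<^sup>L ?M (\<lambda>p. (norm (D p))\<^sup>2)"
  proof (rule integral_dominated_convergence[where w = "\<lambda>p. (norm (D p))\<^sup>2"])
    show "(\<lambda>p. (norm (D p))\<^sup>2) \<in> borel_measurable ?M" using intD by simp
    show "(\<lambda>p. \<eta> n p * (norm (D p))\<^sup>2) \<in> borel_measurable ?M" for n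
      using \<phi>(3) \<eta>_cont
      by (intro borel_measurable_lebesgue_on borel_measurable_continuous_onI continuous_intros) auto
    show "AE p in ?M. (\<lambda>n. \<eta> n p * (norm (D p))\<^sup>2) \<longlonglongrightarrow> (norm (D p))\<^sup>2"
      using tendsto_mult_right[OF \<eta>_lim] by (intro AE_I2) (force simp: space_restrict_space)
    show "AE p in ?M. norm (\<eta> n p * (norm (D p))\<^sup>2) \<le> (norm (D p))\<^sup>2" for n
      using \<eta>[of n] by (intro AE_I2) (simp add: abs_mult mult_left_le_one_le)
  qed (rule intD)
  then show ?thesis by (rule LIMSEQ_le_const2) (use le in blast)
qed

text \<open>The representatives chosen for \<open>\<phi> - w\<close> and for \<open>w\<close> add up
  to some weak gradient of \<open>\<phi>\<close>, whose energy dominates that of the classical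
  gradient. So the arbitrary choice in \<open>weak_gradient\<close> does no harm.\<close>

lemma energy_le_H1_norm:
  assumes \<phi>: "test_function UNIV \<phi>" "\<forall>p. GDERIV \<phi> p :> D p" "continuous_on UNIV D"
    and w: "w \<in> H1" and s: "s > 0"
  shows "integral\<^sup>L (lebesgue_on upper_half_plane) (\<lambda>p. (norm (D p))\<^sup>2 + (\<phi> p)\<^sup>2) \<le>
    (1 + 1 / s) * (H1_norm (\<lambda>p. \<phi> p - w p))\<^sup>2 + (1 + s) * (H1_norm w)\<^sup>2"
proof -
  let ?M = "lebesgue_on upper_half_plane"
  define u where "u p = \<phi> p - w p" for p
  have L2\<phi>: "L2_on upper_half_plane \<phi>" "L2_on upper_half_plane D"
    using test_function_L2[OF \<phi>(1,2)] by auto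
  have L2w: "L2_on upper_half_plane w" using w by (simp add: H1_def)
  note Gw = H1_weak_gradient[OF w]
  have L2u: "L2_on upper_half_plane u"
    using L2_on_add[OF L2\<phi>(1) L2_on_minus[OF L2w]] by (simp add: u_def[abs_def])
  have "has_weak_gradient u (\<lambda>p. D p + - weak_gradient w p)"
    using has_weak_gradient_add[OF L2\<phi>(1) test_function_has_weak_gradient[OF \<phi>] L2_on_minus[OF L2w] has_weak_gradient_minus[OF Gw]]
    by (simp add: u_def[abs_def])
  \<comment> \<open>Without this membership \<open>weak_gradient u\<close> would be an arbitrary
    function and \<open>H1_norm u\<close> would carry no information.\<close>
  then have "u \<in> H1" using L2u by (auto simp: H1_def)
  note Gu = H1_weak_gradient[OF this]
  have L2G: "L2_on upper_half_plane (weak_gradient u)" "L2_on upper_half_plane (weak_gradient w)"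
    using Gu Gw by (auto simp: has_weak_gradient_def)
  \<comment> \<open>Gradient and value form one vector, so that a single use of
    \<open>norm_add_square_le\<close> treats the whole energy density.\<close>
  define P where "P p = (weak_gradient u p, u p)" for p
  define Q where "Q p = (weak_gradient w p, w p)" for p
  have normP: "(norm (P p))\<^sup>2 = (norm (weak_gradient u p))\<^sup>2 + \<bar>u p\<bar>\<^sup>2" for p by (simp add: P_def norm_prod_def)
  have normQ: "(norm (Q p))\<^sup>2 = (norm (weak_gradient w p))\<^sup>2 + \<bar>w p\<bar>\<^sup>2" for p by (simp add: Q_def norm_prod_def)
  have intP: "integrable ?M (\<lambda>p. (norm (P p))\<^sup>2)" and intQ: "integrable ?M (\<lambda>p. (norm (Q p))\<^sup>2)"
    unfolding normP normQ using L2G L2u L2w by (auto simp: L2_on_def)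
  have H1P: "integral\<^sup>L ?M (\<lambda>p. (norm (P p))\<^sup>2) = (H1_norm u)\<^sup>2"
    unfolding H1_norm_def normP by simp
  have H1Q: "integral\<^sup>L ?M (\<lambda>p. (norm (Q p))\<^sup>2) = (H1_norm w)\<^sup>2"
    unfolding H1_norm_def normQ by simp
  have G: "has_weak_gradient \<phi> (\<lambda>p. weak_gradient u p + weak_gradient w p)"
    using has_weak_gradient_add[OF L2u Gu L2w Gw] by (simp add: u_def)
  have intG: "integrable ?M (\<lambda>p. (norm (weak_gradient u p + weak_gradient w p))\<^sup>2)"
    using L2_on_add[OF L2G] by (simp add: L2_on_def)
  have int\<phi>: "integrable ?M (\<lambda>p. (\<phi> p)\<^sup>2)" "integrable ?M (\<lambda>p. (norm (D p))\<^sup>2)"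
    using L2\<phi> by (auto simp: L2_on_def)
  have "integral\<^sup>L ?M (\<lambda>p. (norm (D p))\<^sup>2 + (\<phi> p)\<^sup>2) =
      integral\<^sup>L ?M (\<lambda>p. (norm (D p))\<^sup>2) + integral\<^sup>L ?M (\<lambda>p. (\<phi> p)\<^sup>2)"
    using int\<phi> by simp
  also have "\<dots> \<le> integral\<^sup>L ?M (\<lambda>p. (norm (weak_gradient u p + weak_gradient w p))\<^sup>2) + integral\<^sup>L ?M (\<lambda>p. (\<phi> p)\<^sup>2)"
    by (intro add_right_mono energy_le_weak_gradient[OF \<phi> G])
  also have "\<dots> = integral\<^sup>L ?M (\<lambda>p. (norm (weak_gradient u p + weak_gradient w p))\<^sup>2 + (\<phi> p)\<^sup>2)"
    using int\<phi> intG by simp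
  also have "\<dots> = integral\<^sup>L ?M (\<lambda>p. (norm (P p + Q p))\<^sup>2)"
    by (simp add: P_def Q_def norm_prod_def u_def)
  also have "\<dots> \<le> integral\<^sup>L ?M (\<lambda>p. (1 + 1 / s) * (norm (P p))\<^sup>2 + (1 + s) * (norm (Q p))\<^sup>2)"
  proof (rule integral_mono)
    have "integrable ?M (\<lambda>p. (norm (weak_gradient u p + weak_gradient w p))\<^sup>2 + (\<phi> p)\<^sup>2)"
      using int\<phi> intG by simp
    then show "integrable ?M (\<lambda>p. (norm (P p + Q p))\<^sup>2)"
      by (simp add: P_def Q_def norm_prod_def u_def)
    show "integrable ?M (\<lambda>p. (1 + 1 / s) * (norm (P p))\<^sup>2 + (1 + s) * (norm (Q p))\<^sup>2)"
      using intP intQ by simp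
  qed (rule norm_add_square_le[OF s])
  also have "\<dots> = (1 + 1 / s) * (H1_norm u)\<^sup>2 + (1 + s) * (H1_norm w)\<^sup>2"
    using intP intQ by (simp add: H1P H1Q)
  finally show ?thesis by (simp add: u_def[abs_def])
qed

section \<open>The trace inequality\<close>

lemma nn_integral_half_plane_eq_integral:
  fixes f :: "real \<times> real \<Rightarrow> real"
  assumes "f \<in> borel_measurable borel" "\<And>p. 0 \<le> f p" "integrable (lebesgue_on upper_half_plane) f"
  shows "(\<integral>\<^sup>+p. ennreal (f p) * indicator upper_half_plane p \<partial>lborel) = ennreal (integral\<^sup>L (lebesgue_on upper_half_plane) f)"
proof -
  have "(\<integral>\<^sup>+p. ennreal (f p) * indicator upper_half_plane p \<partial>lborel) =
      (\<integral>\<^sup>+p. ennreal (f p) * indicator upper_half_plane p \<partial>lebesgue)"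
    by (rule nn_integral_completion[symmetric])
  also have "\<dots> = (\<integral>\<^sup>+p. ennreal (f p) \<partial>lebesgue_on upper_half_plane)"
    by (rule nn_integral_restrict_space[symmetric]) auto
  also have "\<dots> = ennreal (integral\<^sup>L (lebesgue_on upper_half_plane) f)"
    using assms by (intro nn_integral_eq_integral) auto
  finally show ?thesis .
qed

text \<open>Multiplying \<open>\<phi>\<close> by \<open>sqrt (\<alpha> / pi)\<close> turns the
  exponent \<alpha> into \<pi>, and the hypothesis on the energy into energy at most 1. The constant
  is that of \<open>Adams_exponential\<close>, hence the same for all \<alpha>.\<close>

lemma Adams_test_function:
  obtains C :: real where "C > 0" "\<And>\<phi> D \<alpha>. test_function UNIV \<phi> \<Longrightarrow> \<forall>p. GDERIV \<phi> p :> D p \<Longrightarrow>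
    continuous_on UNIV D \<Longrightarrow> 0 < \<alpha> \<Longrightarrow>
    \<alpha> * integral\<^sup>L (lebesgue_on upper_half_plane) (\<lambda>p. (norm (D p))\<^sup>2 + (\<phi> p)\<^sup>2) \<le> pi \<Longrightarrow>
    (\<integral>\<^sup>+x. ennreal (exp (\<alpha> * (\<phi> (x, 0))\<^sup>2) - 1) \<partial>lborel) \<le> ennreal C"
proof -
  obtain C :: real where C: "C > 0" "\<And>F v. F \<in> borel_measurable borel \<Longrightarrow> (\<And>p. 0 \<le> F p) \<Longrightarrow>
     (\<integral>\<^sup>+p. ennreal ((F p)\<^sup>2) \<partial>lborel) \<le> 1 \<Longrightarrow> v \<in> borel_measurable borel \<Longrightarrow>
     (\<And>z. ennreal (pi * \<bar>v z\<bar>) \<le> potential 0 (pi / 2) (\<lambda>p. ennreal (F p)) z) \<Longrightarrow>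
     (\<integral>\<^sup>+z. ennreal (exp (pi * (v z)\<^sup>2) - 1) \<partial>lborel) \<le> ennreal C"
    using Adams_exponential by blast
  show ?thesis
  proof (rule that[OF C(1)])
    fix \<phi> D and \<alpha> :: real
    assume \<phi>: "test_function UNIV \<phi>" "\<forall>p. GDERIV \<phi> p :> D p" "continuous_on UNIV D" and \<alpha>: "0 < \<alpha>"
      and energy: "\<alpha> * integral\<^sup>L (lebesgue_on upper_half_plane) (\<lambda>p. (norm (D p))\<^sup>2 + (\<phi> p)\<^sup>2) \<le> pi"
    define l where "l = sqrt (\<alpha> / pi)"
    have l: "0 < l" "l\<^sup>2 = \<alpha> / pi" using \<alpha> by (auto simp: l_def)
    define e where "e p = (norm (l *\<^sub>R D p))\<^sup>2 + (l * \<phi> p)\<^sup>2" for p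
    have e: "0 \<le> e p" "e p = \<alpha> / pi * ((norm (D p))\<^sup>2 + (\<phi> p)\<^sup>2)" for p
      by (simp add: e_def, use l in \<open>simp add: e_def power_mult_distrib distrib_left\<close>)
    have \<phi>_cont: "continuous_on UNIV \<phi>"
      by (intro GDERIV_continuous_on[of \<phi> D] spec[OF \<phi>(2)])
    have e_cont: "continuous_on UNIV e"
      unfolding e_def by (intro continuous_intros \<phi>_cont \<phi>(3))
    have [measurable]: "e \<in> borel_measurable borel"
      by (intro borel_measurable_continuous_onI e_cont)
    \<comment> \<open>\<open>Adams_exponential\<close> measures energy over the whole plane.
      Restricting to the half-plane leaves the potential unchanged, as the kernel vanishes
      elsewhere.\<close>
    define F where "F p = sqrt (e p) * indicator upper_half_plane p" for p
    have [measurable]: "F \<in> borel_measurable borel" unfolding F_def by measurable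
    have "integrable (lebesgue_on upper_half_plane) (\<lambda>p. (norm (D p))\<^sup>2 + (\<phi> p)\<^sup>2)"
      using test_function_L2[OF \<phi>(1,2)] by (auto simp: L2_on_def)
    then have e_int: "integrable (lebesgue_on upper_half_plane) e"
      "integral\<^sup>L (lebesgue_on upper_half_plane) e =
        \<alpha> / pi * integral\<^sup>L (lebesgue_on upper_half_plane) (\<lambda>p. (norm (D p))\<^sup>2 + (\<phi> p)\<^sup>2)"
      unfolding e(2) by simp_all
    have "(\<integral>\<^sup>+z. ennreal (exp (pi * (l * \<phi> (z, 0))\<^sup>2) - 1) \<partial>lborel) \<le> ennreal C"
    proof (rule C(2))
      show "F \<in> borel_measurable borel" by measurable
      show "0 \<le> F p" for p using e(1) by (simp add: F_def)
      have "(\<integral>\<^sup>+p. ennreal ((F p)\<^sup>2) \<partial>lborel) = (\<integral>\<^sup>+p. ennreal (e p) * indicator upper_half_plane p \<partial>lborel)"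
        using e(1) by (intro nn_integral_cong) (auto simp: F_def power_mult_distrib split: split_indicator)
      also have "\<dots> = ennreal (integral\<^sup>L (lebesgue_on upper_half_plane) e)"
        using e(1) e_int by (intro nn_integral_half_plane_eq_integral) auto
      also have "\<dots> \<le> ennreal 1"
        unfolding e_int using energy by (intro ennreal_leI) (simp add: field_simps)
      finally show "(\<integral>\<^sup>+p. ennreal ((F p)\<^sup>2) \<partial>lborel) \<le> 1" by simp
      show "(\<lambda>z. l * \<phi> (z, 0)) \<in> borel_measurable borel"
        by (intro borel_measurable_continuous_onI continuous_intros continuous_on_compose2[OF \<phi>_cont]) auto
      fix z
      have "GDERIV (\<lambda>p. l * \<phi> p) p :> l *\<^sub>R D p" for p
        using GDERIV_mult[OF GDERIV_const[of l] spec[OF \<phi>(2)], of p] by simp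
      then have "ennreal (pi * \<bar>l * \<phi> (z, 0)\<bar>) \<le> potential 0 (pi / 2) (\<lambda>p. ennreal (sqrt (e p))) z"
        unfolding e_def by (rule abs_le_potential) (intro continuous_intros \<phi>(3))
      also have "\<dots> = potential 0 (pi / 2) (\<lambda>p. ennreal (F p)) z"
        unfolding potential_def annulus_kernel_def F_def
        by (intro nn_integral_cong) (auto split: split_indicator)
      finally show "ennreal (pi * \<bar>l * \<phi> (z, 0)\<bar>) \<le> potential 0 (pi / 2) (\<lambda>p. ennreal (F p)) z" .
    qed
    then show "(\<integral>\<^sup>+x. ennreal (exp (\<alpha> * (\<phi> (x, 0))\<^sup>2) - 1) \<partial>lborel) \<le> ennreal C"
      using l by (simp add: power_mult_distrib)
  qed
qed

theorem theorem2p1: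
  shows "\<exists>C::real. C > 0 \<and>
    (\<forall>\<alpha>::real. 0 < \<alpha> \<and> \<alpha> < pi \<longrightarrow>
      (SUP (w, g) \<in> {(w, g). w \<in> H1 \<and> H1_norm w \<le> 1 \<and> has_trace w g}.
         \<integral>\<^sup>+ x. ennreal (exp (\<alpha> * (g x)\<^sup>2) - 1) \<partial>lebesgue) \<le> ennreal C)"
proof -
  obtain C :: real where C: "C > 0" "\<And>\<phi> D \<alpha>. test_function UNIV \<phi> \<Longrightarrow> \<forall>p. GDERIV \<phi> p :> D p \<Longrightarrow>
    continuous_on UNIV D \<Longrightarrow> 0 < \<alpha> \<Longrightarrow>
    \<alpha> * integral\<^sup>L (lebesgue_on upper_half_plane) (\<lambda>p. (norm (D p))\<^sup>2 + (\<phi> p)\<^sup>2) \<le> pi \<Longrightarrow>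
    (\<integral>\<^sup>+x. ennreal (exp (\<alpha> * (\<phi> (x, 0))\<^sup>2) - 1) \<partial>lborel) \<le> ennreal C"
    using Adams_test_function by blast
  have main: "(\<integral>\<^sup>+ x. ennreal (exp (\<alpha> * (g x)\<^sup>2) - 1) \<partial>lebesgue) \<le> ennreal C"
    if \<alpha>: "0 < \<alpha>" "\<alpha> < pi" and w: "w \<in> H1" "H1_norm w \<le> 1" and tr: "has_trace w g" for \<alpha> w g
  proof -
    obtain \<phi> where \<phi>: "\<And>n. test_function UNIV (\<phi> n)"
      and lim: "(\<lambda>n. H1_norm (\<lambda>p. \<phi> n p - w p)) \<longlonglongrightarrow> 0"
      and trace: "(\<lambda>n. integral\<^sup>L lebesgue (\<lambda>x. (\<phi> n (x, 0) - g x)\<^sup>2)) \<longlonglongrightarrow> 0"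
      using tr unfolding has_trace_def by blast
    have g: "L2_on UNIV g" using tr by (simp add: has_trace_def)
    have \<phi>0_cont: "continuous_on UNIV (\<lambda>x. \<phi> n (x, 0))" for n
    proof -
      have "Ck 0 (\<phi> n)" using \<phi>[of n] unfolding test_function_def by blast
      then have "continuous_on UNIV (\<phi> n)" by simp
      then show ?thesis by (rule continuous_on_compose2) (auto intro!: continuous_intros)
    qed
    have \<phi>0_meas: "(\<lambda>x. \<phi> n (x, 0)) \<in> borel_measurable lebesgue" for n
      using borel_measurable_continuous_onI[OF \<phi>0_cont, of n] by (intro measurable_completion) simp
    have \<phi>0_L2: "L2_on UNIV (\<lambda>x. \<phi> n (x, 0))" for n
      unfolding L2_on_def lebesgue_on_UNIV_eq
    proof
      show "(\<lambda>x. \<phi> n (x, 0)) \<in> borel_measurable lebesgue" by (rule \<phi>0_meas)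
      let ?K = "fst ` closure {p. \<phi> n p \<noteq> 0}"
      have "compact ?K"
        using \<phi>[of n] by (intro compact_continuous_image continuous_intros) (simp add: test_function_def)
      moreover have "\<phi> n (x, 0) = 0" if "x \<notin> ?K" for x
      proof (rule ccontr)
        assume "\<phi> n (x, 0) \<noteq> 0"
        then have "(x, 0) \<in> closure {p. \<phi> n p \<noteq> 0}" using closure_subset by fastforce
        then show False using that by force
      qed
      moreover have "continuous_on UNIV (\<lambda>x. (norm (\<phi> n (x, 0)))\<^sup>2)"
        by (intro continuous_intros \<phi>0_cont)
      ultimately have "integrable lborel (\<lambda>x. (norm (\<phi> n (x, 0)))\<^sup>2)"
        by (intro continuous_compact_support_integrable[of _ ?K]) auto
      then show "integrable lebesgue (\<lambda>x. (norm (\<phi> n (x, 0)))\<^sup>2)"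
        using integrable_completion[OF borel_measurable_integrable] by blast
    qed
    \<comment> \<open>The integral of a non-integrable function is 0 by convention; only with
      integrability does \<open>trace\<close> express convergence in L^2, and hence almost
      everywhere along a subsequence.\<close>
    have "integrable lebesgue (\<lambda>x. (\<phi> n (x, 0) - g x)\<^sup>2)" for n
      using L2_on_add[OF \<phi>0_L2[of n] L2_on_minus[OF g]] by (simp add: L2_on_def lebesgue_on_UNIV_eq)
    then obtain r where r: "strict_mono r" "AE x in lebesgue. (\<lambda>n. (\<phi> (r n) (x, 0) - g x)\<^sup>2) \<longlonglongrightarrow> 0"
      using tendsto_L1_AE_subseq[of lebesgue "\<lambda>n x. (\<phi> n (x, 0) - g x)\<^sup>2"] trace by auto
    \<comment> \<open>Chosen so that \<open>2 * s + (1 + s) = pi / \<alpha>\<close>: the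
      approximation error may use \<open>2 * s\<close>, and Young's inequality the remaining s. Here
      \<open>\<alpha> < pi\<close> gives \<open>s > 0\<close>.\<close>
    define s where "s = (pi / \<alpha> - 1) / 3"
    have s: "s > 0" "1 + 3 * s = pi / \<alpha>" using \<alpha> by (auto simp: s_def field_simps)
    have "(\<lambda>n. (1 + 1 / s) * (H1_norm (\<lambda>p. \<phi> n p - w p))\<^sup>2) \<longlonglongrightarrow> (1 + 1 / s) * 0\<^sup>2"
      by (intro tendsto_intros lim)
    then have "\<forall>\<^sub>F n in sequentially. (1 + 1 / s) * (H1_norm (\<lambda>p. \<phi> n p - w p))\<^sup>2 < 2 * s"
      using s by (intro order_tendstoD(2)) auto
    then have "\<forall>\<^sub>F n in sequentially. (\<integral>\<^sup>+x. ennreal (exp (\<alpha> * (\<phi> n (x, 0))\<^sup>2) - 1) \<partial>lebesgue) \<le> ennreal C"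
    proof eventually_elim
      case (elim n)
      have "\<forall>k. Ck k (\<phi> n)" using \<phi>[of n] by (simp add: test_function_def)
      then obtain D where D: "\<forall>p. GDERIV (\<phi> n) p :> D p" "continuous_on UNIV D"
        by (metis smooth_obtains_gradient)
      have H1: "0 \<le> H1_norm w" by (auto simp: H1_norm_def intro!: Bochner_Integration.integral_nonneg)
      have "integral\<^sup>L (lebesgue_on upper_half_plane) (\<lambda>p. (norm (D p))\<^sup>2 + (\<phi> n p)\<^sup>2) \<le>
        (1 + 1 / s) * (H1_norm (\<lambda>p. \<phi> n p - w p))\<^sup>2 + (1 + s) * (H1_norm w)\<^sup>2"
        by (rule energy_le_H1_norm[OF \<phi> D w(1) s(1)])
      also have "\<dots> \<le> 2 * s + (1 + s) * 1"
        using elim s w(2) H1 by (intro add_mono mult_left_mono) (auto simp: power_le_one)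
      also have "\<dots> = pi / \<alpha>" using s(2) by simp
      finally have "\<alpha> * integral\<^sup>L (lebesgue_on upper_half_plane) (\<lambda>p. (norm (D p))\<^sup>2 + (\<phi> n p)\<^sup>2) \<le> pi"
        using \<alpha> by (simp add: field_simps)
      from C(2)[OF \<phi> D \<alpha>(1) this] show ?case by (simp add: nn_integral_completion)
    qed
    then have ev: "\<forall>\<^sub>F n in sequentially. (\<integral>\<^sup>+x. ennreal (exp (\<alpha> * (\<phi> (r n) (x, 0))\<^sup>2) - 1) \<partial>lebesgue) \<le> ennreal C"
      by (rule eventually_subseq[OF r(1)])
    \<comment> \<open>The integrands converge almost everywhere, so the limit can be written as a
      liminf, to which Fatou's lemma applies.\<close>
    have "(\<integral>\<^sup>+x. ennreal (exp (\<alpha> * (g x)\<^sup>2) - 1) \<partial>lebesgue) =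
      (\<integral>\<^sup>+x. liminf (\<lambda>n. ennreal (exp (\<alpha> * (\<phi> (r n) (x, 0))\<^sup>2) - 1)) \<partial>lebesgue)"
    proof (rule nn_integral_cong_AE)
      show "AE x in lebesgue. ennreal (exp (\<alpha> * (g x)\<^sup>2) - 1) = liminf (\<lambda>n. ennreal (exp (\<alpha> * (\<phi> (r n) (x, 0))\<^sup>2) - 1))"
        using r(2)
      proof eventually_elim
        case (elim x)
        then have "(\<lambda>n. sqrt ((\<phi> (r n) (x, 0) - g x)\<^sup>2)) \<longlonglongrightarrow> sqrt 0" by (rule tendsto_real_sqrt)
        then have "(\<lambda>n. \<phi> (r n) (x, 0) - g x) \<longlonglongrightarrow> 0" by (simp add: tendsto_rabs_zero_iff)
        then have "(\<lambda>n. \<phi> (r n) (x, 0)) \<longlonglongrightarrow> g x" by (rule LIM_zero_cancel)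
        then have "(\<lambda>n. ennreal (exp (\<alpha> * (\<phi> (r n) (x, 0))\<^sup>2) - 1)) \<longlonglongrightarrow> ennreal (exp (\<alpha> * (g x)\<^sup>2) - 1)"
          by (intro tendsto_intros)
        then show ?case by (intro lim_imp_Liminf[symmetric]) auto
      qed
    qed
    also have "\<dots> \<le> liminf (\<lambda>n. \<integral>\<^sup>+x. ennreal (exp (\<alpha> * (\<phi> (r n) (x, 0))\<^sup>2) - 1) \<partial>lebesgue)"
    proof (rule nn_integral_liminf)
      fix n
      note [measurable] = \<phi>0_meas[of "r n"]
      show "(\<lambda>x. ennreal (exp (\<alpha> * (\<phi> (r n) (x, 0))\<^sup>2) - 1)) \<in> borel_measurable lebesgue"
        by measurable
    qed
    also have "\<dots> \<le> liminf (\<lambda>n. ennreal C)"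
      by (rule Liminf_mono[OF ev])
    also have "\<dots> = ennreal C" by (rule Liminf_const) simp
    finally show ?thesis .
  qed
  show ?thesis
    using C(1) main by (intro exI[of _ C] conjI allI impI SUP_least) auto
qed

end
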